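(* Let $G$ be a digraph and let $\mathcal{T}$ be a set of pairwise distinguishable tangles in $G$. Then $\mathcal{T}$ has a tree-labelling, i.e. there is a triple $(L,\beta,\gamma)$ where $L$ is a tree, $\beta:V(L)\to\mathcal{T}$ and $\gamma:E(L)\to\mathcal{S}(G)$ are functions such that \begin{enumerate} \item $\beta$ is a bijection between $V(L)$ and $\mathcal{T}$; \item if $t\neq t'\in V(L)$ and $P$ is the unique path in $L$ between $t$ and $t'$, then for every edge $e\in E(P)$ with $|\gamma(e)|=\min\{|\gamma(e')| : e'\in E(P)\}$ the separation $\gamma(e)$ is a minimum order distinguisher between $\beta(t)$ and $\beta(t')$; \item for every edge $e=\{s,s'\}\in E(L)$ there are a node $t$ in the component of $L-e$ containing $s$ and a node $t'$ in the component of $L-e$ containing $s'$ such that $\gamma(e)$ is a minimum order distinguisher of $\beta(t)$ and $\beta(t')$. \end{enumerate}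
   Context: All graphs are finite digraphs. A directed separation of a digraph $G$ is a pair $(A,B)$ of subgraphs of $G$ with $V(A)\cup V(B)=V(G)$ such that either no edge of $G$ has its tail in $V(A)\setminus V(B)$ and its head in $V(B)\setminus V(A)$, or no edge of $G$ has its tail in $V(B)\setminus V(A)$ and its head in $V(A)\setminus V(B)$. Its order $|(A,B)|$ is $|V(A)\cap V(B)|$. $\mathcal{S}(G)$ denotes the set of all directed separations of $G$. A tangle of order $k$ in $G$ is a set $\mathcal{T}$ of directed separations of $G$, each of order $<k$, such that (i) for every directed separation $(A,B)$ of $G$ of order $<k$, $(A,B)\in\mathcal{T}$ or $(B,A)\in\mathcal{T}$, and (ii) for all (not necessarily distinct) $(A_1,B_1),(A_2,B_2),(A_3,B_3)\in\mathcal{T}$ we have $V(A_1)\cup V(A_2)\cup V(A_3)\neq V(G)$. A separation $(A,B)$ distinguishes tangles $T,T'$ (is a $T$–$T'$-distinguisher) if one of $T,T'$ contains $(A,B)$ and the other contains $(B,A)$. Two tangles are distinguishable if some separation distinguishes them. A minimum order distinguisher of $T,T'$ is a $T$–$T'$-distinguisher of smallest order among all $T$–$T'$-distinguishers. *)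

theory Defs
  imports "Graph_Theory.Digraph_Component"
begin

section \<open>Directed separations and tangles\<close>

type_synonym ('a, 'b) separation = "('a, 'b) pre_digraph \<times> ('a, 'b) pre_digraph"

text \<open>The two sides are arbitrary subgraphs whose vertex sets cover \<open>G\<close>; the arcs of \<open>G\<close> need not
  be covered.\<close>

definition dir_separation :: "('a, 'b) pre_digraph \<Rightarrow> ('a, 'b) separation \<Rightarrow> bool" where
  "dir_separation G = (\<lambda>(A, B).
     subgraph A G \<and> subgraph B G \<and> verts A \<union> verts B = verts G \<and>
     (\<not> (\<exists>u \<in> verts A - verts B. \<exists>v \<in> verts B - verts A. u \<rightarrow>\<^bsub>G\<^esub> v) \<or>
      \<not> (\<exists>u \<in> verts B - verts A. \<exists>v \<in> verts A - verts B. u \<rightarrow>\<^bsub>G\<^esub> v)))"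

definition dir_separations :: "('a, 'b) pre_digraph \<Rightarrow> ('a, 'b) separation set" where
  "dir_separations G = {S. dir_separation G S}"

definition sep_order :: "('a, 'b) separation \<Rightarrow> nat" where
  "sep_order = (\<lambda>(A, B). card (verts A \<inter> verts B))"

definition tangle_of_order ::
  "('a, 'b) pre_digraph \<Rightarrow> nat \<Rightarrow> ('a, 'b) separation set \<Rightarrow> bool" where
  "tangle_of_order G k T \<longleftrightarrow>
     (\<forall>S \<in> T. S \<in> dir_separations G \<and> sep_order S < k) \<and>
     (\<forall>A B. (A, B) \<in> dir_separations G \<and> sep_order (A, B) < k \<longrightarrow> (A, B) \<in> T \<or> (B, A) \<in> T) \<and>
     (\<forall>A1 B1 A2 B2 A3 B3. (A1, B1) \<in> T \<and> (A2, B2) \<in> T \<and> (A3, B3) \<in> T \<longrightarrow>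
        verts A1 \<union> verts A2 \<union> verts A3 \<noteq> verts G)"

definition tangle :: "('a, 'b) pre_digraph \<Rightarrow> ('a, 'b) separation set \<Rightarrow> bool" where
  "tangle G T \<longleftrightarrow> (\<exists>k. tangle_of_order G k T)"

definition distinguishes ::
  "('a, 'b) pre_digraph \<Rightarrow> ('a, 'b) separation \<Rightarrow>
   ('a, 'b) separation set \<Rightarrow> ('a, 'b) separation set \<Rightarrow> bool" where
  "distinguishes G S T T' \<longleftrightarrow> S \<in> dir_separations G \<and>
     (case S of (A, B) \<Rightarrow> (A, B) \<in> T \<and> (B, A) \<in> T' \<or> (A, B) \<in> T' \<and> (B, A) \<in> T)"

definition distinguishable ::
  "('a, 'b) pre_digraph \<Rightarrow> ('a, 'b) separation set \<Rightarrow> ('a, 'b) separation set \<Rightarrow> bool" where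
  "distinguishable G T T' \<longleftrightarrow> (\<exists>S. distinguishes G S T T')"

definition min_order_distinguisher ::
  "('a, 'b) pre_digraph \<Rightarrow> ('a, 'b) separation \<Rightarrow>
   ('a, 'b) separation set \<Rightarrow> ('a, 'b) separation set \<Rightarrow> bool" where
  "min_order_distinguisher G S T T' \<longleftrightarrow> distinguishes G S T T' \<and>
     (\<forall>S'. distinguishes G S' T T' \<longrightarrow> sep_order S \<le> sep_order S')"


section \<open>Undirected trees\<close>

record 'v ugraph =
  nodes :: "'v set"
  edges :: "'v set set"

definition simple_ugraph :: "'v ugraph \<Rightarrow> bool" where
  "simple_ugraph L \<longleftrightarrow> finite (nodes L) \<and> (\<forall>e \<in> edges L. e \<subseteq> nodes L \<and> card e = 2)"

definition adjacent :: "'v ugraph \<Rightarrow> 'v \<Rightarrow> 'v \<Rightarrow> bool" where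
  "adjacent L u v \<longleftrightarrow> {u, v} \<in> edges L"

text \<open>Paths are given by their vertex sequences.\<close>

definition path_between :: "'v ugraph \<Rightarrow> 'v \<Rightarrow> 'v list \<Rightarrow> 'v \<Rightarrow> bool" where
  "path_between L u p v \<longleftrightarrow> p \<noteq> [] \<and> hd p = u \<and> last p = v \<and>
     set p \<subseteq> nodes L \<and> distinct p \<and> successively (adjacent L) p"

definition path_edges :: "'v list \<Rightarrow> 'v set set" where
  "path_edges p = {{p ! i, p ! Suc i} | i. Suc i < length p}"

definition cycle_in :: "'v ugraph \<Rightarrow> 'v list \<Rightarrow> bool" where
  "cycle_in L c \<longleftrightarrow> length c \<ge> 3 \<and> distinct c \<and> set c \<subseteq> nodes L \<and>
     successively (adjacent L) c \<and> adjacent L (last c) (hd c)"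

text \<open>The graph without nodes counts as a tree, so that the empty set of tangles needs no special
  treatment; a tree-labelling of a nonempty set of tangles has a nonempty tree.\<close>

definition is_tree :: "'v ugraph \<Rightarrow> bool" where
  "is_tree L \<longleftrightarrow> simple_ugraph L \<and>
     (\<forall>u \<in> nodes L. \<forall>v \<in> nodes L. \<exists>p. path_between L u p v) \<and>
     \<not> (\<exists>c. cycle_in L c)"

definition delete_edge :: "'v ugraph \<Rightarrow> 'v set \<Rightarrow> 'v ugraph" where
  "delete_edge L e = L\<lparr>edges := edges L - {e}\<rparr>"

definition component_of :: "'v ugraph \<Rightarrow> 'v \<Rightarrow> 'v set" where
  "component_of L s = {t. \<exists>p. path_between L s p t}"


section \<open>Tree-labellings\<close>

text \<open>Quantifying over all paths \<open>P\<close> between \<open>t\<close> and \<open>t'\<close> is the same as speaking about the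
  unique one, as \<open>L\<close> is a tree.\<close>

definition tree_labelling ::
  "('a, 'b) pre_digraph \<Rightarrow> ('a, 'b) separation set set \<Rightarrow> 'v ugraph \<Rightarrow>
   ('v \<Rightarrow> ('a, 'b) separation set) \<Rightarrow> ('v set \<Rightarrow> ('a, 'b) separation) \<Rightarrow> bool" where
  "tree_labelling G TT L \<beta> \<gamma> \<longleftrightarrow>
     is_tree L \<and>
     (\<forall>e \<in> edges L. \<gamma> e \<in> dir_separations G) \<and>
     bij_betw \<beta> (nodes L) TT \<and>
     (\<forall>t \<in> nodes L. \<forall>t' \<in> nodes L. \<forall>P. t \<noteq> t' \<and> path_between L t P t' \<longrightarrow>
        (\<forall>e \<in> path_edges P.
           sep_order (\<gamma> e) = Min ((\<lambda>e'. sep_order (\<gamma> e')) ` path_edges P) \<longrightarrow>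
           min_order_distinguisher G (\<gamma> e) (\<beta> t) (\<beta> t'))) \<and>
     (\<forall>s s'. {s, s'} \<in> edges L \<longrightarrow>
        (\<exists>t \<in> component_of (delete_edge L {s, s'}) s.
         \<exists>t' \<in> component_of (delete_edge L {s, s'}) s'.
           min_order_distinguisher G (\<gamma> {s, s'}) (\<beta> t) (\<beta> t')))"

end

theory Submission
  imports Defs
begin

text \<open>Orient every separation so that no edge leads from its first to its second side. If two such
  separations have the minimum order \<open>k\<close> of a distinguisher of tangles in \<open>P\<close>, and both opposite
  corners \<open>(A\<^sub>1 \<union> A\<^sub>2, B\<^sub>1 \<inter> B\<^sub>2)\<close> and \<open>(A\<^sub>1 \<inter> A\<^sub>2, B\<^sub>1 \<union> B\<^sub>2)\<close> are witnessed by tangles, then by submodularity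
  both corners have order \<open>k\<close>. So the bipartitions of \<open>P\<close> induced by separations of order \<open>k\<close> form a
  crossing family, and a crossing family contains a cross-free subfamily \<open>H\<close> that still separates
  the same pairs. If \<open>H\<close> is minimal, each \<open>h \<in> H\<close> has a pair of tangles that only \<open>h\<close> separates;
  splitting \<open>P\<close> along \<open>h\<close>, treating both parts recursively and joining the two trees by an edge
  between that pair gives the tree. Cross-freeness forces an edge of order \<open>k\<close> of either part to
  distinguish all tangles whose path in the joined tree contains it. Once \<open>H\<close> is exhausted, one
  passes to the next larger order. The third condition is the second one for the two ends of an edge.\<close>

section \<open>Crossing families\<close>

text \<open>For subsets of \<open>P\<close> the alternatives say in turn that one of the corners
  \<open>X \<inter> Y\<close>, \<open>P - (X \<union> Y)\<close>, \<open>X - Y\<close>,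
  \<open>Y - X\<close> is empty: the bipartitions of \<open>P\<close> given by \<open>X\<close> and
  \<open>Y\<close> are nested.\<close>

definition uncrossed :: "'p set \<Rightarrow> 'p set \<Rightarrow> 'p set \<Rightarrow> bool" where
  "uncrossed P X Y \<longleftrightarrow> X \<inter> Y = {} \<or> X \<union> Y = P \<or> X \<subseteq> Y \<or> Y \<subseteq> X"

definition separates :: "'p set \<Rightarrow> 'p \<Rightarrow> 'p \<Rightarrow> bool" where
  "separates X a b \<longleftrightarrow> (a \<in> X) \<noteq> (b \<in> X)"

lemma uncrossed_sym: "uncrossed P X Y \<longleftrightarrow> uncrossed P Y X"
  unfolding uncrossed_def by blast

text \<open>The sixteen combinations of alternatives merge into six. Four give the claim at once; in
  the two mixed ones \<open>X\<close> and \<open>Y\<close> would together cover \<open>P\<close>,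
  which crossing sets do not.\<close>

lemma uncrossed_Int:
  assumes "X \<subseteq> P" "Y \<subseteq> P" "Z \<subseteq> P"
    and "uncrossed P Z X" "uncrossed P Z Y" "\<not> uncrossed P X Y"
  shows "uncrossed P Z (X \<inter> Y)"
proof -
  consider "Z \<inter> X = {} \<or> Z \<inter> Y = {}" | "Z \<subseteq> X \<and> Z \<subseteq> Y" | "X \<subseteq> Z \<or> Y \<subseteq> Z"
    | "Z \<union> X = P" "Z \<union> Y = P" | "Z \<union> X = P" "Z \<subseteq> Y" | "Z \<union> Y = P" "Z \<subseteq> X"
    using assms(4,5) unfolding uncrossed_def by blast
  then show ?thesis
  proof cases
    case 5
    then have "X \<union> Y = P" using assms by blast
    then show ?thesis using assms(6) unfolding uncrossed_def by blast
  next
    case 6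
    then have "X \<union> Y = P" using assms by blast
    then show ?thesis using assms(6) unfolding uncrossed_def by blast
  qed (unfold uncrossed_def, blast+)
qed

text \<open>Dual to the intersection: here the mixed combinations would make \<open>X\<close> and
  \<open>Y\<close> disjoint.\<close>

lemma uncrossed_Un:
  assumes "X \<subseteq> P" "Y \<subseteq> P" "Z \<subseteq> P"
    and "uncrossed P Z X" "uncrossed P Z Y" "\<not> uncrossed P X Y"
  shows "uncrossed P Z (X \<union> Y)"
proof -
  consider "Z \<union> X = P \<or> Z \<union> Y = P" | "Z \<subseteq> X \<or> Z \<subseteq> Y" | "X \<subseteq> Z \<and> Y \<subseteq> Z"
    | "Z \<inter> X = {}" "Z \<inter> Y = {}" | "Z \<inter> X = {}" "Y \<subseteq> Z" | "Z \<inter> Y = {}" "X \<subseteq> Z"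
    using assms(4,5) unfolding uncrossed_def by blast
  then show ?thesis
  proof cases
    case 1
    then have "Z \<union> (X \<union> Y) = P" using assms by blast
    then show ?thesis unfolding uncrossed_def by blast
  next
    case 5
    then have "X \<inter> Y = {}" by blast
    then show ?thesis using assms(6) unfolding uncrossed_def by blast
  next
    case 6
    then have "X \<inter> Y = {}" by blast
    then show ?thesis using assms(6) unfolding uncrossed_def by blast
  qed (unfold uncrossed_def, blast+)
qed

text \<open>In a maximal uncrossed subfamily, a pair that is not separated has, among its separators in the
  whole family, one that crosses as few members as possible; replacing it by its intersection or
  union with a crossed member lowers that number.\<close>

lemma crossing_family_uncrossed_separators:
  assumes "finite P" and FP: "F \<subseteq> Pow P"
    and corners: "\<And>X Y. X \<in> F \<Longrightarrow> Y \<in> F \<Longrightarrow> X \<inter> Y \<noteq> {} \<Longrightarrow> X \<union> Y \<noteq> P \<Longrightarrow>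
      X \<inter> Y \<in> F \<and> X \<union> Y \<in> F"
  obtains C where "C \<subseteq> F" "\<And>X Y. X \<in> C \<Longrightarrow> Y \<in> C \<Longrightarrow> uncrossed P X Y"
    "\<And>X a b. X \<in> F \<Longrightarrow> a \<in> P \<Longrightarrow> b \<in> P \<Longrightarrow> separates X a b \<Longrightarrow> \<exists>Y\<in>C. separates Y a b"
    "\<And>X. X \<in> C \<Longrightarrow> \<exists>a\<in>P. \<exists>b\<in>P. \<forall>Y\<in>C. separates Y a b \<longleftrightarrow> Y = X"
proof -
  have finF: "finite F"
    using assms(1,2) by (meson finite_Pow_iff finite_subset)
  define \<C> where "\<C> = {C. C \<subseteq> F \<and> (\<forall>X\<in>C. \<forall>Y\<in>C. uncrossed P X Y)}"
  have "finite \<C>" "{} \<in> \<C>"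
    using finF unfolding \<C>_def by auto
  then obtain M where M: "M \<in> \<C>" and Mmax: "\<And>C. C \<in> \<C> \<Longrightarrow> M \<subseteq> C \<Longrightarrow> M = C"
    using finite_has_maximal2 by metis
  have MF: "M \<subseteq> F" and Mun: "\<And>X Y. X \<in> M \<Longrightarrow> Y \<in> M \<Longrightarrow> uncrossed P X Y"
    using M unfolding \<C>_def by auto
  have finM: "finite M" using MF finF finite_subset by blast
  have sepM: "\<exists>Y\<in>M. separates Y a b"
    if X: "X \<in> F" "a \<in> P" "b \<in> P" "separates X a b" for X a b
  proof (rule ccontr)
    assume none: "\<not> (\<exists>Y\<in>M. separates Y a b)"
    define N where "N = (\<lambda>Y. {Z\<in>M. \<not> uncrossed P Z Y})"
    obtain Y where Y: "Y \<in> F" "separates Y a b"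
      and Ymin: "\<And>W. W \<in> F \<Longrightarrow> separates W a b \<Longrightarrow> card (N Y) \<le> card (N W)"
      using ex_has_least_nat[of "\<lambda>Y. Y \<in> F \<and> separates Y a b" X "\<lambda>Y. card (N Y)"] X by blast
    show False
    proof (cases "N Y = {}")
      case True
      then have ZY: "uncrossed P Z Y \<and> uncrossed P Y Z" if "Z \<in> M" for Z
        using that uncrossed_sym[of P Z Y] unfolding N_def by blast
      have "uncrossed P Y Y" unfolding uncrossed_def by blast
      then have "insert Y M \<in> \<C>"
        using MF Mun Y(1) ZY unfolding \<C>_def by simp
      then have "Y \<in> M" using Mmax[of "insert Y M"] by blast
      then show False using none Y by blast
    next
      case False
      then obtain Z where Z: "Z \<in> M" "\<not> uncrossed P Z Y" unfolding N_def by blast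
      then have ZF: "Z \<in> F" using MF by blast
      have "\<not> separates Z a b" using Z none by blast
      \<comment> \<open>\<open>a\<close> and \<open>b\<close> lie on the same side of
        \<open>Z\<close>. If both are in \<open>Z\<close>, the intersection separates them as
        \<open>Y\<close> does; if both are outside, the union does.\<close>
      then obtain W where W: "W = Z \<inter> Y \<or> W = Z \<union> Y" "separates W a b"
        using Y(2) unfolding separates_def by (cases "a \<in> Z") auto
      have "W \<in> F" using W(1) Z(2) corners[OF ZF Y(1)] unfolding uncrossed_def by blast
      have "N W \<subset> N Y"
      proof
        show "N W \<subseteq> N Y"
        proof
          fix V assume V: "V \<in> N W"
          have "uncrossed P V Z" using V Mun Z unfolding N_def by blast
          moreover have "V \<subseteq> P" "Z \<subseteq> P" "Y \<subseteq> P"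
            using V MF FP ZF Y unfolding N_def by auto
          ultimately have "\<not> uncrossed P V Y"
            using V W(1) Z(2) uncrossed_Int[of Z P Y V] uncrossed_Un[of Z P Y V]
            unfolding N_def by blast
          then show "V \<in> N Y" using V unfolding N_def by blast
        qed
        \<comment> \<open>The inclusion is strict because of \<open>Z\<close>: it crosses
          \<open>Y\<close> but is comparable with \<open>W\<close>, containing the intersection and
          being contained in the union.\<close>
        have "Z \<in> N Y" "Z \<notin> N W"
          using Z W(1) unfolding N_def uncrossed_def by blast+
        then show "N W \<noteq> N Y" by blast
      qed
      then have "card (N W) < card (N Y)"
        using finM unfolding N_def by (intro psubset_card_mono) auto
      then show False using Ymin[OF \<open>W \<in> F\<close> W(2)] by simp
    qed
  qed
  \<comment> \<open>A minimal subfamily of \<open>M\<close> that separates the same pairs: removing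
    a member loses some pair, and that pair is private to the member.\<close>
  define \<D> where "\<D> = {C. C \<subseteq> M \<and> (\<forall>a\<in>P. \<forall>b\<in>P. (\<exists>Y\<in>M. separates Y a b) \<longrightarrow> (\<exists>Y\<in>C. separates Y a b))}"
  have "finite \<D>" "M \<in> \<D>" using finM unfolding \<D>_def by auto
  then obtain C where C: "C \<in> \<D>" and Cmin: "\<And>C'. C' \<in> \<D> \<Longrightarrow> C' \<subseteq> C \<Longrightarrow> C' = C"
    using finite_has_minimal2 by metis
  have CM: "C \<subseteq> M" using C unfolding \<D>_def by blast
  show thesis
  proof
    show "C \<subseteq> F" using CM MF by blast
    show "uncrossed P X Y" if "X \<in> C" "Y \<in> C" for X Y using that CM Mun by blast
    show "\<exists>Y\<in>C. separates Y a b" if "X \<in> F" "a \<in> P" "b \<in> P" "separates X a b" for X a b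
      using sepM[OF that] C that unfolding \<D>_def by blast
    show "\<exists>a\<in>P. \<exists>b\<in>P. \<forall>Y\<in>C. separates Y a b \<longleftrightarrow> Y = X" if "X \<in> C" for X
    proof -
      have "C - {X} \<notin> \<D>" using Cmin[of "C - {X}"] that by blast
      then obtain a b where ab: "a \<in> P" "b \<in> P" "\<exists>Y\<in>M. separates Y a b"
          "\<not> (\<exists>Y\<in>C - {X}. separates Y a b)"
        using CM unfolding \<D>_def by blast
      moreover have "\<exists>Y\<in>C. separates Y a b" using ab C unfolding \<D>_def by blast
      ultimately show ?thesis by blast
    qed
  qed
qed

section \<open>Joining trees by an edge\<close>

lemma path_edges_singleton [simp]: "path_edges [a] = {}"
  unfolding path_edges_def by simp

lemma path_edges_append:
  assumes "p \<noteq> []" "q \<noteq> []"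
  shows "path_edges (p @ q) = path_edges p \<union> path_edges q \<union> {{last p, hd q}}"
proof -
  \<comment> \<open>Splitting off index 0 turns the indexed definition of the edge set into a
    recursion along the list.\<close>
  have Cons2: "path_edges (a # b # r) = insert {a, b} (path_edges (b # r))" for a b :: 'a and r
  proof -
    have "path_edges (a # b # r) = (\<lambda>i. {(a # b # r) ! i, (a # b # r) ! Suc i}) ` {i. Suc i < length (a # b # r)}"
      unfolding path_edges_def by blast
    also have "{i. Suc i < length (a # b # r)} = insert 0 (Suc ` {i. Suc i < length (b # r)})"
      by (auto simp: image_iff gr0_conv_Suc less_Suc_eq_0_disj)
    also have "(\<lambda>i. {(a # b # r) ! i, (a # b # r) ! Suc i}) ` \<dots> =
        insert {a, b} ((\<lambda>i. {(b # r) ! i, (b # r) ! Suc i}) ` {i. Suc i < length (b # r)})"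
      by (auto simp: image_image)
    also have "\<dots> = insert {a, b} (path_edges (b # r))"
      unfolding path_edges_def by blast
    finally show ?thesis .
  qed
  show ?thesis
    using assms(1)
  proof (induction p)
    case (Cons a p)
    show ?case
    proof (cases p)
      case Nil
      then show ?thesis using assms(2) by (cases q) (auto simp: Cons2)
    next
      case (Cons b r)
      then show ?thesis using Cons.IH by (auto simp: Cons2)
    qed
  qed simp
qed

lemma path_edges_subset_edges:
  assumes "path_between L u p v"
  shows "path_edges p \<subseteq> edges L"
  using assms unfolding path_between_def path_edges_def adjacent_def
  by (auto simp: successively_conv_nth)

lemma finite_path_edges: "finite (path_edges p)"
proof -
  have "path_edges p = (\<lambda>i. {p ! i, p ! Suc i}) ` {i. Suc i < length p}"
    unfolding path_edges_def by blast
  moreover have "finite {i. Suc i < length p}"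
    by (rule finite_subset[of _ "{..length p}"]) auto
  ultimately show ?thesis by simp
qed

lemma path_between_refl_iff:
  "path_between L u p u \<longleftrightarrow> p = [u] \<and> u \<in> nodes L"
proof
  assume p: "path_between L u p u"
  then obtain r where r: "p = u # r" unfolding path_between_def by (cases p) auto
  have "r = []"
    using p r unfolding path_between_def by (cases r rule: rev_cases) auto
  then show "p = [u] \<and> u \<in> nodes L" using p r unfolding path_between_def by auto
qed (auto simp: path_between_def)

definition join_trees :: "'v ugraph \<Rightarrow> 'v ugraph \<Rightarrow> 'v \<Rightarrow> 'v \<Rightarrow> 'v ugraph" where
  "join_trees L M x y = \<lparr>nodes = nodes L \<union> nodes M, edges = insert {x, y} (edges L \<union> edges M)\<rparr>"

lemma join_trees_commute: "join_trees L M x y = join_trees M L y x"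
  unfolding join_trees_def by (auto simp: insert_commute)

locale disjoint_trees =
  fixes L M :: "'v ugraph" and x y :: 'v
  assumes tree_L: "is_tree L" and tree_M: "is_tree M"
    and disjoint: "nodes L \<inter> nodes M = {}"
    and x: "x \<in> nodes L" and y: "y \<in> nodes M"
begin

text \<open>Through this symmetry every fact about paths and cycles starting in \<open>L\<close>
  also holds for \<open>M\<close>, so one starting side suffices below.\<close>

lemma swap: "disjoint_trees M L y x"
  using tree_L tree_M disjoint x y by unfold_locales auto

lemma edge_sub: "e \<in> edges L \<Longrightarrow> e \<subseteq> nodes L" "e \<in> edges M \<Longrightarrow> e \<subseteq> nodes M"
  using tree_L tree_M unfolding is_tree_def simple_ugraph_def by auto

lemma adjacent_join_L: "a \<in> nodes L \<Longrightarrow> b \<in> nodes L \<Longrightarrow> adjacent (join_trees L M x y) a b \<longleftrightarrow> adjacent L a b"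
  using edge_sub[of "{a, b}"] disjoint y unfolding join_trees_def adjacent_def
  by (auto simp: doubleton_eq_iff)

lemma adjacent_join_cross: "a \<in> nodes L \<Longrightarrow> b \<in> nodes M \<Longrightarrow> adjacent (join_trees L M x y) a b \<longleftrightarrow> a = x \<and> b = y"
  using edge_sub[of "{a, b}"] disjoint x y unfolding join_trees_def adjacent_def
  by (auto simp: doubleton_eq_iff)

end

text \<open>The only edge between the two node sets is \<open>{x, y}\<close>, so a path that leaves
  \<open>L\<close> uses it, and it cannot return without visiting \<open>x\<close> twice. The
  induction generalises over the trees because the rest of the path after the crossing starts in
  \<open>M\<close>.\<close>

lemma path_join_cases:
  assumes "disjoint_trees L M x y" "successively (adjacent (join_trees L M x y)) p" "distinct p" "set p \<subseteq> nodes L \<union> nodes M"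
    "p \<noteq> []" "hd p \<in> nodes L"
  shows "(set p \<subseteq> nodes L \<and> successively (adjacent L) p) \<or>
    (\<exists>q r. p = q @ r \<and> q \<noteq> [] \<and> r \<noteq> [] \<and> last q = x \<and> hd r = y \<and>
      set q \<subseteq> nodes L \<and> successively (adjacent L) q \<and>
      set r \<subseteq> nodes M \<and> successively (adjacent M) r)"
  using assms
proof (induction p arbitrary: L M x y)
  case (Cons a p)
  interpret disjoint_trees L M x y by (fact Cons.prems(1))
  show ?case
  proof (cases p)
    case Nil
    then show ?thesis using Cons.prems by auto
  next
    case (Cons b s)
    note p = this
    have adj: "adjacent (join_trees L M x y) a b" and prems: "successively (adjacent (join_trees L M x y)) p" "distinct p"
        "set p \<subseteq> nodes L \<union> nodes M" "p \<noteq> []" "a \<in> nodes L" "a \<notin> set p" "hd p = b"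
      using Cons.prems p by auto
    show ?thesis
    proof (cases "b \<in> nodes L")
      case True
      then have ab: "adjacent L a b" using adjacent_join_L adj prems by auto
      have "hd p \<in> nodes L" using True prems by simp
      from Cons.IH[OF Cons.prems(1) prems(1-4) this] show ?thesis
      proof
        assume "set p \<subseteq> nodes L \<and> successively (adjacent L) p"
        then show ?thesis using ab prems p by auto
      next
        assume "\<exists>q r. p = q @ r \<and> q \<noteq> [] \<and> r \<noteq> [] \<and> last q = x \<and> hd r = y \<and>
          set q \<subseteq> nodes L \<and> successively (adjacent L) q \<and>
          set r \<subseteq> nodes M \<and> successively (adjacent M) r"
        then obtain q r where "p = q @ r" "q \<noteq> []" "r \<noteq> []" "last q = x" "hd r = y"
          "set q \<subseteq> nodes L" "successively (adjacent L) q"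
          "set r \<subseteq> nodes M" "successively (adjacent M) r" by blast
        moreover from this have "successively (adjacent L) (a # q)"
          using ab prems by (cases q) auto
        ultimately show ?thesis using prems(5)
          by (intro disjI2 exI[of _ "a # q"] exI[of _ r]) auto
      qed
    next
      case False
      then have bM: "b \<in> nodes M" using prems p by auto
      then have ab: "a = x" "b = y" using adjacent_join_cross adj prems by auto
      have "successively (adjacent (join_trees M L y x)) p" "set p \<subseteq> nodes M \<union> nodes L"
        "hd p \<in> nodes M"
        using prems bM by (auto simp: join_trees_commute[of L M])
      \<comment> \<open>The trees exchange roles. The second alternative of the induction hypothesis
        would put \<open>x\<close>, which is the head \<open>a\<close>, into \<open>p\<close> again,
        against distinctness.\<close>
      from Cons.IH[OF swap this(1) prems(2) this(2) prems(4) this(3)]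
      have "set p \<subseteq> nodes M \<and> successively (adjacent M) p"
        using prems(6) ab by (auto simp: hd_in_set)
      then show ?thesis using ab prems
        by (intro disjI2 exI[of _ "[a]"] exI[of _ p]) auto
    qed
  qed
qed simp

context disjoint_trees
begin

text \<open>A path that uses the joining edge would end in the other tree.\<close>

lemma path_join_within:
  assumes "path_between (join_trees L M x y) t p t'" "t \<in> nodes L" "t' \<in> nodes L"
  shows "path_between L t p t'"
proof -
  have p: "successively (adjacent (join_trees L M x y)) p" "distinct p" "set p \<subseteq> nodes L \<union> nodes M"
    "p \<noteq> []" "hd p = t" "last p = t'"
    using assms(1) unfolding path_between_def by (auto simp: join_trees_def)
  have "\<not> (r \<noteq> [] \<and> set r \<subseteq> nodes M \<and> p = q @ r)" for q r
  proof
    assume r: "r \<noteq> [] \<and> set r \<subseteq> nodes M \<and> p = q @ r"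
    then have "t' \<in> set r" using p by auto
    then show False using r assms(3) disjoint by blast
  qed
  then have "set p \<subseteq> nodes L \<and> successively (adjacent L) p"
    using path_join_cases[OF disjoint_trees_axioms p(1-4)] p(5) assms(2) by blast
  then show ?thesis using p unfolding path_between_def by auto
qed

lemma path_join_across:
  assumes "path_between (join_trees L M x y) t p t'" "t \<in> nodes L" "t' \<in> nodes M"
  obtains q r where "p = q @ r" "path_between L t q x" "path_between M y r t'"
proof -
  have p: "successively (adjacent (join_trees L M x y)) p" "distinct p" "set p \<subseteq> nodes L \<union> nodes M"
    "p \<noteq> []" "hd p = t" "last p = t'"
    using assms(1) unfolding path_between_def by (auto simp: join_trees_def)
  have "\<not> set p \<subseteq> nodes L" using p assms(3) disjoint last_in_set[of p] by auto
  then obtain q r where "p = q @ r" "q \<noteq> []" "r \<noteq> []" "last q = x" "hd r = y"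
          "set q \<subseteq> nodes L" "successively (adjacent L) q"
          "set r \<subseteq> nodes M" "successively (adjacent M) r"
    using path_join_cases[OF disjoint_trees_axioms p(1-4)] p(5) assms(2) by blast
  then show thesis using p by (intro that[of q r]) (auto simp: path_between_def)
qed

lemma path_join_ex:
  assumes "t \<in> nodes L" "t' \<in> nodes L \<union> nodes M"
  shows "\<exists>p. path_between (join_trees L M x y) t p t'"
proof -
  have mono: "successively (adjacent (join_trees L M x y)) p" if "successively (adjacent L) p \<or> successively (adjacent M) p" for p
    using that by (auto elim!: successively_mono simp: adjacent_def join_trees_def)
  show ?thesis
  proof (cases "t' \<in> nodes L")
    case True
    then obtain p where "path_between L t p t'" using assms tree_L unfolding is_tree_def by blast
    then show ?thesis using mono[of p] unfolding path_between_def
      by (intro exI[of _ p]) (auto simp: join_trees_def)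
  next
    case False
    obtain q where q: "path_between L t q x" using assms x tree_L unfolding is_tree_def by blast
    obtain r where r: "path_between M y r t'" using False assms y tree_M unfolding is_tree_def by blast
    have "adjacent (join_trees L M x y) x y" by (simp add: adjacent_def join_trees_def)
    then have "path_between (join_trees L M x y) t (q @ r) t'" using q r mono[of q] mono[of r] disjoint
      unfolding path_between_def by (auto simp: successively_append_iff join_trees_def)
    then show ?thesis by blast
  qed
qed

text \<open>A cycle is a path closed by one edge. If both ends of that path lie in \<open>L\<close>,
  the whole cycle does, but \<open>L\<close> has none; otherwise the closing edge is the joining
  edge. Cycles that start in \<open>M\<close> are left to symmetry.\<close>

lemma cycle_join_hd: "cycle_in (join_trees L M x y) c \<Longrightarrow> hd c \<notin> nodes L"
proof
  assume c: "cycle_in (join_trees L M x y) c" and hd: "hd c \<in> nodes L"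
  have c': "3 \<le> length c" "c \<noteq> []" "distinct c" "path_between (join_trees L M x y) (hd c) c (last c)" "adjacent (join_trees L M x y) (last c) (hd c)"
    using c unfolding cycle_in_def path_between_def by auto
  have "last c \<in> nodes L \<union> nodes M"
    using last_in_set[OF c'(2)] c unfolding cycle_in_def by (auto simp: join_trees_def)
  then consider "last c \<in> nodes L" | "last c \<in> nodes M" by blast
  then show False
  proof cases
    case 1
    then have "path_between L (hd c) c (last c)" using path_join_within[OF c'(4) hd] by simp
    moreover have "adjacent L (last c) (hd c)" using adjacent_join_L[OF 1 hd] c' by simp
    ultimately have "cycle_in L c" using c' unfolding cycle_in_def path_between_def by auto
    then show False using tree_L unfolding is_tree_def by blast
  next
    case 2
    have "adjacent (join_trees L M x y) (hd c) (last c)" using c'(5) by (simp add: adjacent_def insert_commute)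
    then have e: "hd c = x" "last c = y" using adjacent_join_cross[OF hd 2] by auto
    obtain q r where "c = q @ r" "path_between L (hd c) q x" "path_between M y r (last c)"
      using path_join_across[OF c'(4) hd 2] .
    \<comment> \<open>Now \<open>q\<close> runs from \<open>x\<close> to \<open>x\<close> and
      \<open>r\<close> from \<open>y\<close> to \<open>y\<close>, so both are single nodes and
      \<open>c\<close> has length 2, short of the required 3.\<close>
    then show False using c'(1) e by (auto simp: path_between_refl_iff)
  qed
qed

lemma is_tree_join_trees: "is_tree (join_trees L M x y)"
proof -
  interpret S: disjoint_trees M L y x by (fact swap)
  have "simple_ugraph (join_trees L M x y)"
  proof -
    have "x \<noteq> y" using x y disjoint by blast
    then have "card {x, y} = 2" by simp
    then show ?thesis
      using tree_L tree_M x y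
      unfolding is_tree_def simple_ugraph_def by (auto simp: join_trees_def)
  qed
  moreover have "\<exists>p. path_between (join_trees L M x y) u p v" if "u \<in> nodes (join_trees L M x y)" "v \<in> nodes (join_trees L M x y)" for u v
    using that path_join_ex[of u v] S.path_join_ex[of u v]
    by (auto simp: join_trees_def Un_commute insert_commute)
  moreover have "\<not> cycle_in (join_trees L M x y) c" for c
  proof
    assume c: "cycle_in (join_trees L M x y) c"
    then have "hd c \<in> nodes L \<union> nodes M" unfolding cycle_in_def join_trees_def by (cases c) auto
    then show False using cycle_join_hd[OF c] S.cycle_join_hd[of c] c by (auto simp: join_trees_commute[of L M])
  qed
  ultimately show ?thesis unfolding is_tree_def by blast
qed

end

section \<open>Tangles and corners of separations\<close>

text \<open>For a tangle and a directed separation this expresses that the order of \<open>S\<close>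
  is below that of the tangle, without naming the order that \<open>tangle\<close> hides under a
  quantifier.\<close>

definition orients :: "('a, 'b) separation set \<Rightarrow> ('a, 'b) separation \<Rightarrow> bool" where
  "orients T S \<longleftrightarrow> S \<in> T \<or> prod.swap S \<in> T"

lemma swap_in_dir_separations [simp]:
  "prod.swap S \<in> dir_separations G \<longleftrightarrow> S \<in> dir_separations G"
  unfolding dir_separations_def dir_separation_def by (cases S) auto

lemma sep_order_swap [simp]: "sep_order (prod.swap S) = sep_order S"
  unfolding sep_order_def by (cases S) (auto simp: Int_commute)

lemma tangle_dir_separation: "tangle G T \<Longrightarrow> S \<in> T \<Longrightarrow> S \<in> dir_separations G"
  unfolding tangle_def tangle_of_order_def by blast

lemma tangle_no_cover:
  "tangle G T \<Longrightarrow> (A1, B1) \<in> T \<Longrightarrow> (A2, B2) \<in> T \<Longrightarrow> (A3, B3) \<in> T \<Longrightarrow>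
    verts A1 \<union> verts A2 \<union> verts A3 \<noteq> verts G"
  unfolding tangle_def tangle_of_order_def by blast

lemma dir_separation_cover: "(A, B) \<in> dir_separations G \<Longrightarrow> verts A \<union> verts B = verts G"
  unfolding dir_separations_def dir_separation_def by blast

lemma tangle_orients_le:
  assumes "tangle G T" "orients T S" "S' \<in> dir_separations G" "sep_order S' \<le> sep_order S"
  shows "orients T S'"
proof -
  obtain k where k: "tangle_of_order G k T" using assms(1) unfolding tangle_def by blast
  have "sep_order S < k"
    using assms(2) k sep_order_swap[of S] unfolding orients_def tangle_of_order_def by metis
  then have "sep_order S' < k" using assms(4) by simp
  then show ?thesis
    using k assms(3) unfolding tangle_of_order_def orients_def by (cases S') auto
qed

text \<open>The two sides of a separation cover \<open>G\<close>, and the three members in the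
  covering axiom may coincide.\<close>

lemma tangle_swap_notin:
  assumes "tangle G T" "S \<in> T"
  shows "prod.swap S \<notin> T"
proof
  assume s: "prod.swap S \<in> T"
  obtain A B where S: "S = (A, B)" by (cases S)
  then show False
    using s tangle_no_cover[OF assms(1), of A B A B B A] assms
      dir_separation_cover[of A B G] tangle_dir_separation[OF assms] by auto
qed

text \<open>Otherwise \<open>(D, C)\<close> would be in the tangle, and its first side would
  complete a cover together with \<open>A1\<close> and \<open>A2\<close>.\<close>

lemma tangle_closed:
  assumes "tangle G T" "(A1, B1) \<in> T" "(A2, B2) \<in> T" "orients T (C, D)"
    "verts A1 \<union> verts A2 \<union> verts D = verts G"
  shows "(C, D) \<in> T"
  using tangle_no_cover[OF assms(1-3), of D C] assms(4,5) unfolding orients_def by auto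

text \<open>A tangle that orients \<open>S\<close> contains exactly one of \<open>S\<close> and its
  swap. This reduces distinguishers to bipartitions of a set of tangles, which is how they are
  handled from here on.\<close>

lemma distinguishes_iff:
  assumes "tangle G T" "tangle G T'" "orients T S" "orients T' S"
  shows "distinguishes G S T T' \<longleftrightarrow> (S \<in> T) \<noteq> (S \<in> T')"
proof -
  have "S \<in> dir_separations G"
    using assms tangle_dir_separation[of G T S] tangle_dir_separation[of G T "prod.swap S"]
    unfolding orients_def by auto
  then show ?thesis
    using assms tangle_swap_notin[of G T S] tangle_swap_notin[of G T' S]
    unfolding distinguishes_def orients_def by (cases S) auto
qed

lemma distinguishes_orients:
  "distinguishes G S T T' \<Longrightarrow> orients T S \<and> orients T' S"
  unfolding distinguishes_def orients_def by auto

lemma distinguishes_swap: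
  "distinguishes G (prod.swap S) T T' \<longleftrightarrow> distinguishes G S T T'"
  using swap_in_dir_separations[of S G] unfolding distinguishes_def by (cases S) auto

lemma distinguishes_commute: "distinguishes G S T T' \<longleftrightarrow> distinguishes G S T' T"
  unfolding distinguishes_def by auto

section \<open>Corners of separations with a common direction\<close>

text \<open>One fixed disjunct of the definition of a directed separation, stated for vertex sets so
  that unions and intersections of sides can be inserted directly.\<close>

definition forward :: "('a, 'b) pre_digraph \<Rightarrow> 'a set \<Rightarrow> 'a set \<Rightarrow> bool" where
  "forward G V W \<longleftrightarrow> \<not> (\<exists>u \<in> V - W. \<exists>v \<in> W - V. u \<rightarrow>\<^bsub>G\<^esub> v)"

lemma dir_separation_forward:
  assumes "(A, B) \<in> dir_separations G"
  shows "forward G (verts A) (verts B) \<or> forward G (verts B) (verts A)"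
  using assms unfolding dir_separations_def dir_separation_def forward_def by blast

text \<open>By the cover conditions, an arc in the wrong direction across a corner is already one
  across one of the two given separations. Both must point the same way for this.\<close>

lemma forward_corners:
  assumes "V1 \<union> W1 = X" "V2 \<union> W2 = X" "forward G V1 W1" "forward G V2 W2"
  shows "forward G (V1 \<union> V2) (W1 \<inter> W2)" "forward G (V1 \<inter> V2) (W1 \<union> W2)"
proof -
  have no_arc: False
    if "u \<in> V1 - W1 \<and> v \<in> W1 - V1 \<or> u \<in> V2 - W2 \<and> v \<in> W2 - V2" "u \<rightarrow>\<^bsub>G\<^esub> v" for u v
    using that assms(3,4) unfolding forward_def by blast
  have cov: "u \<in> V1 \<or> u \<in> W1 \<longleftrightarrow> u \<in> V2 \<or> u \<in> W2" for u
    using assms(1,2) by blast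
  show "forward G (V1 \<union> V2) (W1 \<inter> W2)"
    unfolding forward_def
  proof (intro notI, elim bexE)
    fix u v assume "u \<in> V1 \<union> V2 - W1 \<inter> W2" "v \<in> W1 \<inter> W2 - (V1 \<union> V2)" "u \<rightarrow>\<^bsub>G\<^esub> v"
    then show False using no_arc[of u v] cov[of u] by auto
  qed
  show "forward G (V1 \<inter> V2) (W1 \<union> W2)"
    unfolding forward_def
  proof (intro notI, elim bexE)
    fix u v assume "u \<in> V1 \<inter> V2 - (W1 \<union> W2)" "v \<in> W1 \<union> W2 - V1 \<inter> V2" "u \<rightarrow>\<^bsub>G\<^esub> v"
    then show False using no_arc[of u v] cov[of v] by auto
  qed
qed

text \<open>Membership of a separation in a tangle only depends on the vertex sets of its two sides, so
  corners of separations may be represented by edgeless subgraphs.\<close>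

definition edgeless :: "('a, 'b) pre_digraph \<Rightarrow> 'a set \<Rightarrow> ('a, 'b) pre_digraph" where
  "edgeless G V = \<lparr>verts = V, arcs = {}, tail = tail G, head = head G\<rparr>"

lemma verts_edgeless [simp]: "verts (edgeless G V) = V"
  unfolding edgeless_def by simp

lemma forward_edgeless_separation:
  assumes "wf_digraph G" "V \<union> W = verts G" "forward G V W"
  shows "(edgeless G V, edgeless G W) \<in> dir_separations G"
proof -
  have "subgraph (edgeless G U) G" if "U \<subseteq> verts G" for U
    using that assms(1) unfolding subgraph_def edgeless_def
    by (auto simp: compatible_def wf_digraph_def)
  then show ?thesis
    using assms(2,3) unfolding dir_separations_def dir_separation_def forward_def by auto
qed

text \<open>Compatibility fixes the tail and head maps, so a subgraph is determined by its vertex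
  and arc sets. This later bounds the number of tangles.\<close>

lemma finite_dir_separations:
  assumes "fin_digraph G"
  shows "finite (dir_separations G)"
proof -
  interpret fin_digraph G by (fact assms)
  define sub where "sub = (\<lambda>(V, E). \<lparr>verts = V, arcs = E, tail = tail G, head = head G\<rparr>)"
  have "H \<in> sub ` (Pow (verts G) \<times> Pow (arcs G))" if "subgraph H G" for H
    using that unfolding sub_def subgraph_def compatible_def
    by (intro image_eqI[of _ _ "(verts H, arcs H)"]) auto
  then have "dir_separations G \<subseteq>
      (sub ` (Pow (verts G) \<times> Pow (arcs G))) \<times> (sub ` (Pow (verts G) \<times> Pow (arcs G)))"
    unfolding dir_separations_def dir_separation_def by auto
  then show ?thesis
    by (rule finite_subset) simp
qed

text \<open>The last clause gives every separation \<open>S\<close> a private pair of tangles; joining that pair by an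
  edge labelled \<open>S\<close> is how the tree is built.\<close>

definition level_separators ::
  "('a, 'b) pre_digraph \<Rightarrow> ('v \<Rightarrow> ('a, 'b) separation set) \<Rightarrow> 'v set \<Rightarrow> nat \<Rightarrow>
   ('a, 'b) separation set \<Rightarrow> bool" where
  "level_separators G \<tau> P k H \<longleftrightarrow>
     (\<forall>S. \<forall>i\<in>P. \<forall>j\<in>P. distinguishes G S (\<tau> i) (\<tau> j) \<longrightarrow> k \<le> sep_order S) \<and>
     (\<forall>S\<in>H. S \<in> dir_separations G \<and> sep_order S = k \<and> (\<forall>i\<in>P. orients (\<tau> i) S)) \<and>
     (\<forall>S\<in>H. \<forall>S'\<in>H. uncrossed P {i\<in>P. S \<in> \<tau> i} {i\<in>P. S' \<in> \<tau> i}) \<and>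
     (\<forall>S. \<forall>i\<in>P. \<forall>j\<in>P. sep_order S = k \<and> distinguishes G S (\<tau> i) (\<tau> j) \<longrightarrow>
        (\<exists>S'\<in>H. distinguishes G S' (\<tau> i) (\<tau> j))) \<and>
     (\<forall>S\<in>H. \<exists>i\<in>P. \<exists>j\<in>P. \<forall>S'\<in>H. distinguishes G S' (\<tau> i) (\<tau> j) \<longleftrightarrow> S' = S)"

text \<open>This is the situation where \<open>k\<close> is the least order of a separation
  distinguishing two tangles of \<open>P\<close>: \<open>low\<close> bounds the order of corners
  from below, and \<open>ori\<close> makes every tangle decide the separations of order up to
  \<open>k\<close>.\<close>

locale tangle_level = fin_digraph G
  for G :: "('a, 'b) pre_digraph" +
  fixes \<tau> :: "'v \<Rightarrow> ('a, 'b) separation set" and P :: "'v set" and k :: nat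
  assumes finite_P: "finite P"
    and tan: "\<And>i. i \<in> P \<Longrightarrow> tangle G (\<tau> i)"
    and ori: "\<And>i S. i \<in> P \<Longrightarrow> S \<in> dir_separations G \<Longrightarrow> sep_order S \<le> k \<Longrightarrow> orients (\<tau> i) S"
    and low: "\<And>i j S. i \<in> P \<Longrightarrow> j \<in> P \<Longrightarrow> distinguishes G S (\<tau> i) (\<tau> j) \<Longrightarrow> k \<le> sep_order S"
begin

text \<open>First sides are the small ones, so the corner with the union of the first sides belongs
  to exactly those tangles that contain both separations, and the other corner to those that contain
  at least one. Hence both corners distinguish \<open>c\<close> from \<open>d\<close> and have order
  at least \<open>k\<close>, while their orders add up to \<open>k + k\<close>.\<close>

lemma corner_separations:
  assumes S1: "(A1, B1) \<in> dir_separations G" "sep_order (A1, B1) = k" "forward G (verts A1) (verts B1)"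
    and S2: "(A2, B2) \<in> dir_separations G" "sep_order (A2, B2) = k" "forward G (verts A2) (verts B2)"
    and c: "c \<in> P" "(A1, B1) \<in> \<tau> c" "(A2, B2) \<in> \<tau> c"
    and d: "d \<in> P" "(A1, B1) \<notin> \<tau> d" "(A2, B2) \<notin> \<tau> d"
  defines "U \<equiv> (edgeless G (verts A1 \<union> verts A2), edgeless G (verts B1 \<inter> verts B2))"
    and "W \<equiv> (edgeless G (verts A1 \<inter> verts A2), edgeless G (verts B1 \<union> verts B2))"
  shows "U \<in> dir_separations G" "sep_order U = k"
    "W \<in> dir_separations G" "sep_order W = k"
    "\<And>i. i \<in> P \<Longrightarrow> U \<in> \<tau> i \<longleftrightarrow> (A1, B1) \<in> \<tau> i \<and> (A2, B2) \<in> \<tau> i"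
    "\<And>i. i \<in> P \<Longrightarrow> W \<in> \<tau> i \<longleftrightarrow> (A1, B1) \<in> \<tau> i \<or> (A2, B2) \<in> \<tau> i"
proof -
  have cov: "verts A1 \<union> verts B1 = verts G" "verts A2 \<union> verts B2 = verts G"
    using S1 S2 dir_separation_cover by blast+
  show Usep: "U \<in> dir_separations G"
    unfolding U_def
    by (rule forward_edgeless_separation[OF wf_digraph_axioms])
      (use cov forward_corners[OF cov S1(3) S2(3)] in auto)
  show Wsep: "W \<in> dir_separations G"
    unfolding W_def
    by (rule forward_edgeless_separation[OF wf_digraph_axioms])
      (use cov forward_corners[OF cov S1(3) S2(3)] in auto)
  have fin: "finite (verts A1)" "finite (verts B1)" "finite (verts A2)" "finite (verts B2)"
    using cov finite_verts by (metis finite_Un)+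
  have sum: "sep_order U + sep_order W = k + k"
  proof -
    let ?a1 = "verts A1" and ?b1 = "verts B1" and ?a2 = "verts A2" and ?b2 = "verts B2"
    let ?u = "(?a1 \<union> ?a2) \<inter> (?b1 \<inter> ?b2)" and ?w = "(?a1 \<inter> ?a2) \<inter> (?b1 \<union> ?b2)"
    \<comment> \<open>The separators of the two corners have the same union and the same
      intersection as those of the two given separations.\<close>
    have "card ?u + card ?w = card (?u \<union> ?w) + card (?u \<inter> ?w)"
      using fin by (intro card_Un_Int) auto
    also have "?u \<union> ?w = (?a1 \<inter> ?b1) \<union> (?a2 \<inter> ?b2)" using cov by blast
    also have "?u \<inter> ?w = (?a1 \<inter> ?b1) \<inter> (?a2 \<inter> ?b2)" using cov by blast
    also have "card ((?a1 \<inter> ?b1) \<union> (?a2 \<inter> ?b2)) + card ((?a1 \<inter> ?b1) \<inter> (?a2 \<inter> ?b2)) =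
        card (?a1 \<inter> ?b1) + card (?a2 \<inter> ?b2)"
      using fin by (intro card_Un_Int[symmetric]) auto
    finally show ?thesis
      using S1(2) S2(2) unfolding U_def W_def sep_order_def by simp
  qed
  have in_swap: "(B1, A1) \<in> \<tau> i \<longleftrightarrow> (A1, B1) \<notin> \<tau> i" "(B2, A2) \<in> \<tau> i \<longleftrightarrow> (A2, B2) \<notin> \<tau> i"
    if "i \<in> P" for i
    using ori[OF that S1(1)] ori[OF that S2(1)] S1(2) S2(2)
      tangle_swap_notin[OF tan[OF that], of "(A1, B1)"]
      tangle_swap_notin[OF tan[OF that], of "(A2, B2)"]
    unfolding orients_def by auto
  \<comment> \<open>Orientation of the corner is a premise here because its order is not yet known
    to be at most \<open>k\<close>.\<close>
  have U_side: "U \<in> \<tau> i \<longleftrightarrow> (A1, B1) \<in> \<tau> i \<and> (A2, B2) \<in> \<tau> i"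
    if i: "i \<in> P" and U: "orients (\<tau> i) U" for i
  proof
    assume UT: "U \<in> \<tau> i"
    show "(A1, B1) \<in> \<tau> i \<and> (A2, B2) \<in> \<tau> i"
    proof (rule ccontr)
      assume "\<not> ?thesis"
      then consider "(B1, A1) \<in> \<tau> i" | "(B2, A2) \<in> \<tau> i" using in_swap i by blast
      then show False
      proof cases
        case 1
        show False
          using tangle_no_cover[OF tan[OF i] 1 1 UT[unfolded U_def]] cov by auto
      next
        case 2
        show False
          using tangle_no_cover[OF tan[OF i] 2 2 UT[unfolded U_def]] cov by auto
      qed
    qed
  next
    assume S: "(A1, B1) \<in> \<tau> i \<and> (A2, B2) \<in> \<tau> i"
    show "U \<in> \<tau> i"
      unfolding U_def
      by (rule tangle_closed[OF tan[OF i], of A1 B1 A2 B2])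
        (use S U cov in \<open>auto simp: U_def\<close>)
  qed
  have W_side: "W \<in> \<tau> i \<longleftrightarrow> (A1, B1) \<in> \<tau> i \<or> (A2, B2) \<in> \<tau> i"
    if i: "i \<in> P" and W: "orients (\<tau> i) W" for i
  proof
    assume WT: "W \<in> \<tau> i"
    show "(A1, B1) \<in> \<tau> i \<or> (A2, B2) \<in> \<tau> i"
    proof (rule ccontr)
      assume "\<not> ?thesis"
      then have B: "(B1, A1) \<in> \<tau> i" "(B2, A2) \<in> \<tau> i" using in_swap i by blast+
      show False
        using tangle_no_cover[OF tan[OF i] B WT[unfolded W_def]] cov by auto
    qed
  next
    assume "(A1, B1) \<in> \<tau> i \<or> (A2, B2) \<in> \<tau> i"
    then show "W \<in> \<tau> i"
    proof
      assume S: "(A1, B1) \<in> \<tau> i"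
      show ?thesis
        unfolding W_def
        by (rule tangle_closed[OF tan[OF i] S S]) (use W cov in \<open>auto simp: W_def\<close>)
    next
      assume S: "(A2, B2) \<in> \<tau> i"
      show ?thesis
        unfolding W_def
        by (rule tangle_closed[OF tan[OF i] S S]) (use W cov in \<open>auto simp: W_def\<close>)
    qed
  qed
  \<comment> \<open>A smaller order would make \<open>c\<close> and \<open>d\<close> orient the
    corner, hence differ on it, against \<open>low\<close>.\<close>
  have "k \<le> sep_order U"
  proof (rule ccontr)
    assume "\<not> ?thesis"
    then have "sep_order U \<le> k" "\<not> k \<le> sep_order U" by auto
    then show False
      using low[OF c(1) d(1), of U] ori[OF _ Usep] U_side c d
        distinguishes_iff[OF tan[OF c(1)] tan[OF d(1)], of U] by auto
  qed
  moreover have "k \<le> sep_order W"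
  proof (rule ccontr)
    assume "\<not> ?thesis"
    then have "sep_order W \<le> k" "\<not> k \<le> sep_order W" by auto
    then show False
      using low[OF c(1) d(1), of W] ori[OF _ Wsep] W_side c d
        distinguishes_iff[OF tan[OF c(1)] tan[OF d(1)], of W] by auto
  qed
  ultimately show ord: "sep_order U = k" "sep_order W = k" using sum by auto
  show "U \<in> \<tau> i \<longleftrightarrow> (A1, B1) \<in> \<tau> i \<and> (A2, B2) \<in> \<tau> i" if "i \<in> P" for i
    using U_side[OF that] ori[OF that Usep] ord by simp
  show "W \<in> \<tau> i \<longleftrightarrow> (A1, B1) \<in> \<tau> i \<or> (A2, B2) \<in> \<tau> i" if "i \<in> P" for i
    using W_side[OF that] ori[OF that Wsep] ord by simp
qed

lemma ex_level_separators: "\<exists>H. level_separators G \<tau> P k H"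
proof -
  define side where "side = (\<lambda>S. {i\<in>P. S \<in> \<tau> i})"
  \<comment> \<open>Only separations pointing forward are collected, since corners need a common
    direction.\<close>
  define \<S> where "\<S> = {S. S \<in> dir_separations G \<and> sep_order S = k \<and>
      forward G (verts (fst S)) (verts (snd S))}"
  have ori': "orients (\<tau> i) S" if "S \<in> \<S>" "i \<in> P" for i S
    using ori[OF that(2), of S] that(1) unfolding \<S>_def by simp
  have dist: "distinguishes G S (\<tau> i) (\<tau> j) \<longleftrightarrow> separates (side S) i j"
    if "S \<in> \<S>" "i \<in> P" "j \<in> P" for S i j
    using distinguishes_iff[OF tan[OF that(2)] tan[OF that(3)]] ori' that
    unfolding separates_def side_def by simp
  have corners: "X \<inter> Y \<in> side ` \<S> \<and> X \<union> Y \<in> side ` \<S>"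
    if XY: "X \<in> side ` \<S>" "Y \<in> side ` \<S>" "X \<inter> Y \<noteq> {}" "X \<union> Y \<noteq> P" for X Y
  proof -
    obtain A1 B1 A2 B2 where X: "X = side (A1, B1)" "(A1, B1) \<in> \<S>"
      and Y: "Y = side (A2, B2)" "(A2, B2) \<in> \<S>"
      using XY by (metis imageE surj_pair)
    obtain c where c: "c \<in> P" "(A1, B1) \<in> \<tau> c" "(A2, B2) \<in> \<tau> c"
      using XY X Y unfolding side_def by blast
    have "X \<union> Y \<subseteq> P" using X Y unfolding side_def by blast
    then obtain d where d: "d \<in> P" "(A1, B1) \<notin> \<tau> d" "(A2, B2) \<notin> \<tau> d"
      using XY X Y unfolding side_def by blast
    let ?U = "(edgeless G (verts A1 \<union> verts A2), edgeless G (verts B1 \<inter> verts B2))"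
    let ?W = "(edgeless G (verts A1 \<inter> verts A2), edgeless G (verts B1 \<union> verts B2))"
    have S: "(A1, B1) \<in> dir_separations G" "sep_order (A1, B1) = k" "forward G (verts A1) (verts B1)"
      "(A2, B2) \<in> dir_separations G" "sep_order (A2, B2) = k" "forward G (verts A2) (verts B2)"
      using X Y unfolding \<S>_def by auto
    note cs = corner_separations[OF S c d]
    have "?U \<in> \<S>" "?W \<in> \<S>"
      using cs(1-4) forward_corners[OF dir_separation_cover[OF S(1)] dir_separation_cover[OF S(4)] S(3,6)]
      unfolding \<S>_def by simp_all
    moreover have "X \<inter> Y = side ?U" "X \<union> Y = side ?W"
      using cs(5,6) X(1) Y(1) unfolding side_def by auto
    ultimately show ?thesis by blast
  qed
  have "side ` \<S> \<subseteq> Pow P" unfolding side_def by blast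
  from crossing_family_uncrossed_separators[OF finite_P this corners]
  obtain C where C: "C \<subseteq> side ` \<S>" "\<And>X Y. X \<in> C \<Longrightarrow> Y \<in> C \<Longrightarrow> uncrossed P X Y"
    "\<And>X a b. X \<in> side ` \<S> \<Longrightarrow> a \<in> P \<Longrightarrow> b \<in> P \<Longrightarrow> separates X a b \<Longrightarrow> \<exists>Y\<in>C. separates Y a b"
    "\<And>X. X \<in> C \<Longrightarrow> \<exists>a\<in>P. \<exists>b\<in>P. \<forall>Y\<in>C. separates Y a b \<longleftrightarrow> Y = X"
    by blast
  \<comment> \<open>Several separations may induce the same subset of \<open>P\<close>. One
    representative for each member of \<open>C\<close> is kept, so that private pairs carry over
    from subsets to separations.\<close>
  obtain H where H: "H \<subseteq> \<S>" "inj_on side H" "side ` H = C"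
    using C(1) subset_image_inj[of C side \<S>] by auto
  have "level_separators G \<tau> P k H"
    unfolding level_separators_def
  proof (intro conjI allI ballI impI)
    fix S i j assume "i \<in> P" "j \<in> P" "distinguishes G S (\<tau> i) (\<tau> j)"
    then show "k \<le> sep_order S" using low by blast
  next
    fix S assume S: "S \<in> H"
    show "S \<in> dir_separations G" "sep_order S = k" using S H(1) unfolding \<S>_def by auto
    show "orients (\<tau> i) S" if "i \<in> P" for i using S H(1) ori' that by blast
  next
    fix S S' assume "S \<in> H" "S' \<in> H"
    then show "uncrossed P {i \<in> P. S \<in> \<tau> i} {i \<in> P. S' \<in> \<tau> i}"
      using C(2) H(3) unfolding side_def by blast
  next
    fix S i j assume ij: "i \<in> P" "j \<in> P" and S: "sep_order S = k \<and> distinguishes G S (\<tau> i) (\<tau> j)"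
    have "S \<in> dir_separations G" using S unfolding distinguishes_def by blast
    moreover obtain A B where AB: "S = (A, B)" by (cases S)
    \<comment> \<open>Swapping makes any distinguisher point forward without changing its order or
      the pairs it distinguishes.\<close>
    moreover define S' where "S' = (if forward G (verts A) (verts B) then S else prod.swap S)"
    ultimately have S': "S' = S \<or> S' = prod.swap S" "S' \<in> \<S>"
      using dir_separation_forward[of A B G] S sep_order_swap[of S] swap_in_dir_separations[of S G]
      unfolding \<S>_def by auto
    have "separates (side S') i j"
      using S'(1) dist[OF S'(2) ij] S distinguishes_swap[of G S "\<tau> i" "\<tau> j"] by (elim disjE) simp_all
    then have "\<exists>Y\<in>C. separates Y i j" using C(3)[of "side S'" i j] S' ij by blast
    then show "\<exists>S'\<in>H. distinguishes G S' (\<tau> i) (\<tau> j)"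
    proof
      fix Y assume Y: "Y \<in> C" "separates Y i j"
      then obtain S'' where S'': "S'' \<in> H" "side S'' = Y" using H(3) by blast
      then have "distinguishes G S'' (\<tau> i) (\<tau> j)"
        using dist[OF subsetD[OF H(1) S''(1)] ij] Y(2) by simp
      then show "\<exists>S'\<in>H. distinguishes G S' (\<tau> i) (\<tau> j)" using S''(1) by blast
    qed
  next
    fix S assume S: "S \<in> H"
    then obtain a b where ab: "a \<in> P" "b \<in> P" "\<forall>Y\<in>C. separates Y a b \<longleftrightarrow> Y = side S"
      using C(4)[of "side S"] H(3) by blast
    have "distinguishes G S' (\<tau> a) (\<tau> b) \<longleftrightarrow> S' = S" if "S' \<in> H" for S'
    proof -
      have "side S' \<in> C" using H(3) that by blast
      then show ?thesis
        using dist[OF subsetD[OF H(1) that] ab(1,2)] ab(3) inj_on_eq_iff[OF H(2) that S] by simp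
    qed
    then show "\<exists>i\<in>P. \<exists>j\<in>P. \<forall>S'\<in>H. distinguishes G S' (\<tau> i) (\<tau> j) \<longleftrightarrow> S' = S"
      using ab by blast
  qed
  then show ?thesis by blast
qed

end

section \<open>Recursive construction of the tree\<close>

text \<open>The second condition of a tree-labelling, with the minimum replaced by
  comparisons.\<close>

definition min_labels ::
  "('a, 'b) pre_digraph \<Rightarrow> ('v \<Rightarrow> ('a, 'b) separation set) \<Rightarrow> 'v ugraph \<Rightarrow>
   ('v set \<Rightarrow> ('a, 'b) separation) \<Rightarrow> bool" where
  "min_labels G \<tau> L \<gamma> \<longleftrightarrow>
     (\<forall>t\<in>nodes L. \<forall>t'\<in>nodes L. \<forall>p. t \<noteq> t' \<and> path_between L t p t' \<longrightarrow>
       (\<forall>e\<in>path_edges p. (\<forall>e'\<in>path_edges p. sep_order (\<gamma> e) \<le> sep_order (\<gamma> e')) \<longrightarrow>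
         min_order_distinguisher G (\<gamma> e) (\<tau> t) (\<tau> t')))"

text \<open>The invariant of the recursion. The lower bound makes a joining edge of order
  \<open>k\<close> minimal on every path through it, and labels of order exactly \<open>k\<close>
  stay in the cross-free family.\<close>

definition labelled_tree ::
  "('a, 'b) pre_digraph \<Rightarrow> ('v \<Rightarrow> ('a, 'b) separation set) \<Rightarrow> 'v set \<Rightarrow> nat \<Rightarrow>
   ('a, 'b) separation set \<Rightarrow> 'v ugraph \<Rightarrow> ('v set \<Rightarrow> ('a, 'b) separation) \<Rightarrow> bool" where
  "labelled_tree G \<tau> P k H L \<gamma> \<longleftrightarrow> is_tree L \<and> nodes L = P \<and>
     (\<forall>e\<in>edges L. \<gamma> e \<in> dir_separations G \<and> k \<le> sep_order (\<gamma> e) \<and>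
        (sep_order (\<gamma> e) = k \<longrightarrow> \<gamma> e \<in> H)) \<and>
     min_labels G \<tau> L \<gamma>"

lemma min_labelsD:
  assumes "min_labels G \<tau> L \<gamma>" "path_between L t p t'" "t \<noteq> t'" "t \<in> nodes L" "t' \<in> nodes L"
    "e \<in> path_edges p" "\<forall>e'\<in>path_edges p. sep_order (\<gamma> e) \<le> sep_order (\<gamma> e')"
  shows "min_order_distinguisher G (\<gamma> e) (\<tau> t) (\<tau> t')"
  using assms unfolding min_labels_def by blast

lemma labelled_treeD:
  assumes "labelled_tree G \<tau> P k H L \<gamma>"
  shows "is_tree L" "nodes L = P" "min_labels G \<tau> L \<gamma>"
    "e \<in> edges L \<Longrightarrow> \<gamma> e \<in> dir_separations G" "e \<in> edges L \<Longrightarrow> k \<le> sep_order (\<gamma> e)"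
    "e \<in> edges L \<Longrightarrow> sep_order (\<gamma> e) = k \<Longrightarrow> \<gamma> e \<in> H"
  using assms unfolding labelled_tree_def by blast+

text \<open>Only labels on edges matter, which allows the labellings of two trees to be merged into
  one function.\<close>

lemma labelled_tree_cong:
  assumes "labelled_tree G \<tau> P k H L \<gamma>" "\<And>e. e \<in> edges L \<Longrightarrow> \<gamma>' e = \<gamma> e"
  shows "labelled_tree G \<tau> P k H L \<gamma>'"
proof -
  have "min_labels G \<tau> L \<gamma>'"
    unfolding min_labels_def
  proof (intro ballI allI impI)
    fix t t' p e
    assume t: "t \<in> nodes L" "t' \<in> nodes L" "t \<noteq> t' \<and> path_between L t p t'" "e \<in> path_edges p"
      and min: "\<forall>e'\<in>path_edges p. sep_order (\<gamma>' e) \<le> sep_order (\<gamma>' e')"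
    have "\<gamma>' e' = \<gamma> e'" if "e' \<in> path_edges p" for e'
      using that t(3) path_edges_subset_edges[of L t p t'] assms(2) by blast
    then show "min_order_distinguisher G (\<gamma>' e) (\<tau> t) (\<tau> t')"
      using min_labelsD[OF labelled_treeD(3)[OF assms(1)], of t p t' e] t min by simp
  qed
  then show ?thesis using assms unfolding labelled_tree_def by simp
qed

lemma level_separatorsD:
  assumes "level_separators G \<tau> P k H"
  shows "distinguishes G S (\<tau> i) (\<tau> j) \<Longrightarrow> i \<in> P \<Longrightarrow> j \<in> P \<Longrightarrow> k \<le> sep_order S"
    "S \<in> H \<Longrightarrow> S \<in> dir_separations G" "S \<in> H \<Longrightarrow> sep_order S = k"
    "S \<in> H \<Longrightarrow> i \<in> P \<Longrightarrow> orients (\<tau> i) S"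
    "S \<in> H \<Longrightarrow> S' \<in> H \<Longrightarrow> uncrossed P {i\<in>P. S \<in> \<tau> i} {i\<in>P. S' \<in> \<tau> i}"
    "distinguishes G S (\<tau> i) (\<tau> j) \<Longrightarrow> sep_order S = k \<Longrightarrow> i \<in> P \<Longrightarrow> j \<in> P \<Longrightarrow>
      \<exists>S'\<in>H. distinguishes G S' (\<tau> i) (\<tau> j)"
    "S \<in> H \<Longrightarrow> \<exists>i\<in>P. \<exists>j\<in>P. \<forall>S'\<in>H. distinguishes G S' (\<tau> i) (\<tau> j) \<longleftrightarrow> S' = S"
  using assms unfolding level_separators_def by (simp_all del: split_paired_All) blast+

context
  fixes G :: "('a, 'b) pre_digraph" and \<tau> :: "'v \<Rightarrow> ('a, 'b) separation set"
begin

section \<open>Restricting a level to one side of a separator\<close>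

lemma level_distinguishes_iff:
  assumes "level_separators G \<tau> P k H" "\<forall>i\<in>P. tangle G (\<tau> i)" "S \<in> H" "i \<in> P" "j \<in> P"
  shows "distinguishes G S (\<tau> i) (\<tau> j) \<longleftrightarrow> (S \<in> \<tau> i) \<noteq> (S \<in> \<tau> j)"
  using assms(2-) level_separatorsD(4)[OF assms(1)] by (intro distinguishes_iff) auto

lemma level_no_crossing:
  assumes "level_separators G \<tau> P k H" "S \<in> H" "S' \<in> H"
    "a \<in> P" "S \<in> \<tau> a" "S' \<in> \<tau> a"
    "b \<in> P" "S \<in> \<tau> b" "S' \<notin> \<tau> b"
    "c \<in> P" "S \<notin> \<tau> c" "S' \<in> \<tau> c"
    "d \<in> P" "S \<notin> \<tau> d" "S' \<notin> \<tau> d"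
  shows False
proof -
  have "uncrossed P {i \<in> P. S \<in> \<tau> i} {i \<in> P. S' \<in> \<tau> i}"
    by (rule level_separatorsD(5)[OF assms(1-3)])
  then show False
    using assms(4-) unfolding uncrossed_def by (elim disjE) (simp_all add: set_eq_iff subset_iff, blast+)
qed

text \<open>The clause at stake is the last: the private pair of a remaining \<open>S\<close> must
  lie in \<open>Z\<close>. It lies on one side of \<open>h\<close>, as \<open>h\<close> does not
  distinguish it. On the side other than \<open>Z\<close> it would, with the pair in
  \<open>Z\<close> that \<open>S\<close> distinguishes, make \<open>S\<close> cross
  \<open>h\<close>.\<close>

lemma level_separators_side:
  assumes level: "level_separators G \<tau> P k H" and tan: "\<forall>i\<in>P. tangle G (\<tau> i)"
    and h: "h \<in> H" and Z: "Z = {i\<in>P. h \<in> \<tau> i} \<or> Z = {i\<in>P. h \<notin> \<tau> i}"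
  shows "level_separators G \<tau> Z k {S\<in>H - {h}. \<exists>i\<in>Z. \<exists>j\<in>Z. distinguishes G S (\<tau> i) (\<tau> j)}"
    (is "level_separators G \<tau> Z k ?H")
proof -
  have ZP: "Z \<subseteq> P" using Z by blast
  note dist = level_distinguishes_iff[OF level tan]
  have hZ: "\<not> distinguishes G h (\<tau> i) (\<tau> j)" if "i \<in> Z" "j \<in> Z" for i j
    using that dist[OF h, of i j] Z by auto
  show ?thesis
    unfolding level_separators_def
  proof (intro conjI allI ballI impI)
    fix S i j assume "i \<in> Z" "j \<in> Z" "distinguishes G S (\<tau> i) (\<tau> j)"
    then show "k \<le> sep_order S" using level_separatorsD(1)[OF level] ZP by blast
  next
    fix S assume S: "S \<in> ?H"
    show "S \<in> dir_separations G" "sep_order S = k"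
      using S level_separatorsD(2,3)[OF level] by simp_all
    show "orients (\<tau> i) S" if "i \<in> Z" for i
      using S level_separatorsD(4)[OF level] ZP that by blast
  next
    fix S S' assume "S \<in> ?H" "S' \<in> ?H"
    then have "uncrossed P {i \<in> P. S \<in> \<tau> i} {i \<in> P. S' \<in> \<tau> i}"
      using level_separatorsD(5)[OF level] by blast
    then show "uncrossed Z {i \<in> Z. S \<in> \<tau> i} {i \<in> Z. S' \<in> \<tau> i}"
      using ZP unfolding uncrossed_def by blast
  next
    fix S i j
    assume ij: "i \<in> Z" "j \<in> Z" and S: "sep_order S = k \<and> distinguishes G S (\<tau> i) (\<tau> j)"
    have "i \<in> P" "j \<in> P" using ij ZP by auto
    then obtain S' where S': "S' \<in> H" "distinguishes G S' (\<tau> i) (\<tau> j)"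
      using level_separatorsD(6)[OF level] S by blast
    then have "S' \<noteq> h" using hZ ij by blast
    then show "\<exists>S'\<in>?H. distinguishes G S' (\<tau> i) (\<tau> j)" using S' ij by blast
  next
    fix S assume S: "S \<in> ?H"
    then have SH: "S \<in> H" "S \<noteq> h" by auto
    then obtain i j where ij: "i \<in> P" "j \<in> P"
      and only: "\<forall>S'\<in>H. distinguishes G S' (\<tau> i) (\<tau> j) \<longleftrightarrow> S' = S"
      using level_separatorsD(7)[OF level] by meson
    have hij: "(h \<in> \<tau> i) = (h \<in> \<tau> j)" using only h SH dist[OF h ij] by auto
    have Sij: "(S \<in> \<tau> i) \<noteq> (S \<in> \<tau> j)" using only SH dist[OF SH(1) ij] by auto
    have "i \<in> Z"
    proof (rule ccontr)
      assume "i \<notin> Z"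
      obtain a b where ab: "a \<in> Z" "b \<in> Z" "distinguishes G S (\<tau> a) (\<tau> b)" using S by blast
      then have abP: "a \<in> P" "b \<in> P" and Sab: "(S \<in> \<tau> a) \<noteq> (S \<in> \<tau> b)"
        using ZP dist[OF SH(1), of a b] by auto
      have "(h \<in> \<tau> a) = (h \<in> \<tau> b)" "(h \<in> \<tau> a) \<noteq> (h \<in> \<tau> i)"
        using Z ab(1,2) ij \<open>i \<notin> Z\<close> by auto
      then show False
        using level_no_crossing[OF level h SH(1)] abP ij Sab Sij hij by (metis (full_types))
    qed
    moreover from this have "j \<in> Z" using Z ij hij by auto
    ultimately show "\<exists>i\<in>Z. \<exists>j\<in>Z. \<forall>S'\<in>?H. distinguishes G S' (\<tau> i) (\<tau> j) \<longleftrightarrow> S' = S"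
      using only by blast
  qed
qed

lemma level_min_order_distinguisher:
  assumes "level_separators G \<tau> P k H" "i \<in> P" "j \<in> P" "distinguishes G S (\<tau> i) (\<tau> j)" "sep_order S = k"
  shows "min_order_distinguisher G S (\<tau> i) (\<tau> j)"
  using assms level_separatorsD(1)[OF assms(1)] unfolding min_order_distinguisher_def by simp

section \<open>Gluing two labelled trees\<close>

text \<open>The path uses the edge labelled \<open>h\<close>, so its minimum order is
  \<open>k\<close> and a minimal label is in \<open>H\<close>. Inside either tree such a label
  distinguishes the two ends of its part of the path, and this has to be extended across the joining
  edge.\<close>

lemma min_label_across:
  assumes dt: "disjoint_trees L M x y" and P: "nodes L \<union> nodes M = P"
    and level: "level_separators G \<tau> P k H" and tan: "\<forall>i\<in>P. tangle G (\<tau> i)"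
    and h: "h \<in> H" and xy: "\<forall>S\<in>H. distinguishes G S (\<tau> x) (\<tau> y) \<longleftrightarrow> S = h"
    and split: "\<forall>i\<in>nodes L. \<forall>j\<in>nodes M. distinguishes G h (\<tau> i) (\<tau> j)"
    and L: "labelled_tree G \<tau> (nodes L) k (H - {h}) L \<gamma>"
    and M: "labelled_tree G \<tau> (nodes M) k (H - {h}) M \<gamma>"
    and \<gamma>h: "\<gamma> {x, y} = h"
    and p: "path_between (join_trees L M x y) t p t'" "t \<in> nodes L" "t' \<in> nodes M"
    and e: "e \<in> path_edges p" "\<forall>e'\<in>path_edges p. sep_order (\<gamma> e) \<le> sep_order (\<gamma> e')"
  shows "min_order_distinguisher G (\<gamma> e) (\<tau> t) (\<tau> t')"
proof -
  interpret disjoint_trees L M x y by (fact dt)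
  obtain q r where qr: "p = q @ r" "path_between L t q x" "path_between M y r t'"
    using path_join_across[OF p] .
  have "q \<noteq> []" "r \<noteq> []" "last q = x" "hd r = y"
    using qr unfolding path_between_def by auto
  then have pe: "path_edges p = path_edges q \<union> path_edges r \<union> {{x, y}}"
    using path_edges_append qr(1) by metis
  note dist = level_distinguishes_iff[OF level tan]
  have inP: "t \<in> P" "t' \<in> P" "x \<in> P" "y \<in> P" using P p x y by auto
  have "sep_order h = k" using level_separatorsD(3)[OF level h] .
  then have e_le: "sep_order (\<gamma> e) \<le> k" using e(2) pe \<gamma>h by simp
  have htx: "(h \<in> \<tau> t) \<noteq> (h \<in> \<tau> y)" "(h \<in> \<tau> t) \<noteq> (h \<in> \<tau> t')" "(h \<in> \<tau> x) \<noteq> (h \<in> \<tau> t')"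
    using split p(2,3) x y dist[OF h] inP by blast+
  \<comment> \<open>The label does not distinguish \<open>x\<close> from \<open>y\<close>, a pair
    private to \<open>h\<close>. If it did not distinguish \<open>t\<close> from \<open>t'\<close>
    either, then \<open>t\<close>, \<open>x\<close>, \<open>y\<close>, \<open>t'\<close> would
    occupy all four corners with \<open>h\<close>.\<close>
  have across: "min_order_distinguisher G (\<gamma> e) (\<tau> t) (\<tau> t')"
    if S: "\<gamma> e \<in> H" "\<gamma> e \<noteq> h" "sep_order (\<gamma> e) = k"
      and d: "distinguishes G (\<gamma> e) (\<tau> t) (\<tau> x) \<or> distinguishes G (\<gamma> e) (\<tau> y) (\<tau> t')"
  proof -
    have "(\<gamma> e \<in> \<tau> x) = (\<gamma> e \<in> \<tau> y)" using xy S(1,2) dist[OF S(1) inP(3,4)] by auto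
    moreover have "(\<gamma> e \<in> \<tau> t) \<noteq> (\<gamma> e \<in> \<tau> x) \<or> (\<gamma> e \<in> \<tau> y) \<noteq> (\<gamma> e \<in> \<tau> t')"
      using d dist[OF S(1) inP(1,3)] dist[OF S(1) inP(4,2)] by auto
    ultimately have "(\<gamma> e \<in> \<tau> t) \<noteq> (\<gamma> e \<in> \<tau> t')"
      using level_no_crossing[OF level h S(1)] htx inP by (metis (full_types))
    then show ?thesis
      using level_min_order_distinguisher[OF level inP(1,2) _ S(3)] dist[OF S(1) inP(1,2)] by auto
  qed
  consider "e = {x, y}" | "e \<in> path_edges q" | "e \<in> path_edges r" using e(1) pe by blast
  then show ?thesis
  proof cases
    case 1
    then show ?thesis
      using level_min_order_distinguisher[OF level inP(1,2)] split p(2,3) \<gamma>h \<open>sep_order h = k\<close>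
      by simp
  next
    case 2
    have "e \<in> edges L" using 2 path_edges_subset_edges[OF qr(2)] by blast
    then have S: "sep_order (\<gamma> e) = k" "\<gamma> e \<in> H - {h}"
      using L e_le unfolding labelled_tree_def by (auto simp: antisym)
    have "t \<noteq> x" using 2 qr(2) by (auto simp: path_between_refl_iff)
    then have "min_order_distinguisher G (\<gamma> e) (\<tau> t) (\<tau> x)"
      using min_labelsD[OF labelled_treeD(3)[OF L] qr(2)] 2 p(2) x e(2) pe by blast
    then show ?thesis using across S unfolding min_order_distinguisher_def by blast
  next
    case 3
    have "e \<in> edges M" using 3 path_edges_subset_edges[OF qr(3)] by blast
    then have S: "sep_order (\<gamma> e) = k" "\<gamma> e \<in> H - {h}"
      using M e_le unfolding labelled_tree_def by (auto simp: antisym)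
    have "y \<noteq> t'" using 3 qr(3) by (auto simp: path_between_refl_iff)
    then have "min_order_distinguisher G (\<gamma> e) (\<tau> y) (\<tau> t')"
      using min_labelsD[OF labelled_treeD(3)[OF M] qr(3)] 3 p(3) y e(2) pe by blast
    then show ?thesis using across S unfolding min_order_distinguisher_def by blast
  qed
qed

lemma labelled_tree_join:
  assumes dt: "disjoint_trees L M x y" and P: "nodes L \<union> nodes M = P"
    and level: "level_separators G \<tau> P k H" and tan: "\<forall>i\<in>P. tangle G (\<tau> i)"
    and h: "h \<in> H" and xy: "\<forall>S\<in>H. distinguishes G S (\<tau> x) (\<tau> y) \<longleftrightarrow> S = h"
    and split: "\<forall>i\<in>nodes L. \<forall>j\<in>nodes M. distinguishes G h (\<tau> i) (\<tau> j)"
    and L: "labelled_tree G \<tau> (nodes L) k (H - {h}) L \<gamma>"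
    and M: "labelled_tree G \<tau> (nodes M) k (H - {h}) M \<gamma>"
    and \<gamma>h: "\<gamma> {x, y} = h"
  shows "labelled_tree G \<tau> P k H (join_trees L M x y) \<gamma>"
proof -
  interpret disjoint_trees L M x y by (fact dt)
  interpret S: disjoint_trees M L y x by (fact swap)
  let ?J = "join_trees L M x y"
  have J: "?J = join_trees M L y x" by (rule join_trees_commute)
  have split': "\<forall>i\<in>nodes M. \<forall>j\<in>nodes L. distinguishes G h (\<tau> i) (\<tau> j)"
    using split distinguishes_commute by blast
  have xy': "\<forall>S\<in>H. distinguishes G S (\<tau> y) (\<tau> x) \<longleftrightarrow> S = h"
    using xy distinguishes_commute by metis
  have \<gamma>h': "\<gamma> {y, x} = h" using \<gamma>h by (simp add: insert_commute)
  have P': "nodes M \<union> nodes L = P" using P by blast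
  have "min_labels G \<tau> ?J \<gamma>"
    unfolding min_labels_def
  proof (intro ballI allI impI)
    fix t t' p e
    assume t: "t \<in> nodes ?J" "t' \<in> nodes ?J" and p: "t \<noteq> t' \<and> path_between ?J t p t'"
      and e: "e \<in> path_edges p" "\<forall>e'\<in>path_edges p. sep_order (\<gamma> e) \<le> sep_order (\<gamma> e')"
    have p': "path_between ?J t p t'" "path_between (join_trees M L y x) t p t'"
      using p J by auto
    consider "t \<in> nodes L" "t' \<in> nodes L" | "t \<in> nodes M" "t' \<in> nodes M"
      | "t \<in> nodes L" "t' \<in> nodes M" | "t \<in> nodes M" "t' \<in> nodes L"
      using t unfolding join_trees_def by auto
    then show "min_order_distinguisher G (\<gamma> e) (\<tau> t) (\<tau> t')"
    proof cases
      case 1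
      then show ?thesis
        using min_labelsD[OF labelled_treeD(3)[OF L] path_join_within[OF p'(1)]] p e by blast
    next
      case 2
      then show ?thesis
        using min_labelsD[OF labelled_treeD(3)[OF M] S.path_join_within[OF p'(2)]] p e by blast
    next
      case 3
      show ?thesis
        by (rule min_label_across[OF dt P level tan h xy split L M \<gamma>h p'(1) 3 e])
    next
      case 4
      show ?thesis
        by (rule min_label_across[OF swap P' level tan h xy' split' M L \<gamma>h' p'(2) 4 e])
    qed
  qed
  moreover have "\<gamma> e \<in> dir_separations G \<and> k \<le> sep_order (\<gamma> e) \<and>
      (sep_order (\<gamma> e) = k \<longrightarrow> \<gamma> e \<in> H)" if e: "e \<in> edges ?J" for e
  proof -
    consider "e = {x, y}" | "e \<in> edges L" | "e \<in> edges M"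
      using e unfolding join_trees_def by auto
    then show ?thesis
    proof cases
      case 1
      then show ?thesis using level_separatorsD(2,3)[OF level h] h \<gamma>h by simp
    next
      case 2
      then show ?thesis using L unfolding labelled_tree_def by blast
    next
      case 3
      then show ?thesis using M unfolding labelled_tree_def by blast
    qed
  qed
  moreover have "nodes ?J = P" using P unfolding join_trees_def by simp
  ultimately show ?thesis
    using is_tree_join_trees unfolding labelled_tree_def by blast
qed

lemma labelled_tree_mono:
  "labelled_tree G \<tau> P k H L \<gamma> \<Longrightarrow> H \<subseteq> H' \<Longrightarrow> labelled_tree G \<tau> P k H' L \<gamma>"
  unfolding labelled_tree_def by blast

lemma labelled_tree_trivial:
  assumes "finite P" "card P \<le> 1"
  shows "labelled_tree G \<tau> P k H \<lparr>nodes = P, edges = {}\<rparr> \<gamma>"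
proof -
  let ?L = "\<lparr>nodes = P, edges = {}\<rparr>"
  have eq: "u = v" if "u \<in> P" "v \<in> P" for u v
    using assms that card_le_Suc0_iff_eq[of P] by simp
  have "path_between ?L u [u] v" if "u \<in> P" "v \<in> P" for u v
    using eq[OF that] that unfolding path_between_def by simp
  moreover have "\<not> cycle_in ?L c" for c
    unfolding cycle_in_def adjacent_def by simp
  ultimately have "is_tree ?L"
    using assms unfolding is_tree_def simple_ugraph_def by auto
  moreover have "min_labels G \<tau> ?L \<gamma>" unfolding min_labels_def using eq by auto
  ultimately show ?thesis unfolding labelled_tree_def by simp
qed

section \<open>Choice of the level and recursion\<close>

lemma ex_nonempty_level_separators:
  assumes G: "fin_digraph G" and P: "finite P" "1 < card P"
    and tan: "\<forall>i\<in>P. tangle G (\<tau> i)"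
    and dis: "\<forall>i\<in>P. \<forall>j\<in>P. i \<noteq> j \<longrightarrow> distinguishable G (\<tau> i) (\<tau> j)"
  obtains k H where "level_separators G \<tau> P k H" "H \<noteq> {}"
    "\<exists>S. \<exists>i\<in>P. \<exists>j\<in>P. distinguishes G S (\<tau> i) (\<tau> j) \<and> sep_order S = k"
proof -
  define D where "D = (\<lambda>S. \<exists>i\<in>P. \<exists>j\<in>P. distinguishes G S (\<tau> i) (\<tau> j))"
  have other: "\<exists>j\<in>P. j \<noteq> i" if "i \<in> P" for i
  proof (rule ccontr)
    assume "\<not> ?thesis"
    then have "P \<subseteq> {i}" by blast
    then show False using P(2) card_mono[of "{i}" P] by simp
  qed
  obtain i where "i \<in> P" using P by fastforce
  then obtain S0 where "D S0" using other dis unfolding D_def distinguishable_def by metis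
  then obtain S where S: "D S" and Smin: "\<And>S'. D S' \<Longrightarrow> sep_order S \<le> sep_order S'"
    using ex_has_least_nat[of D S0 sep_order] by blast
  interpret fin_digraph G by (fact G)
  have "tangle_level G \<tau> P (sep_order S)"
  proof unfold_locales
    show "finite P" by (fact P)
    show "tangle G (\<tau> i)" if "i \<in> P" for i using tan that by blast
    show "sep_order S \<le> sep_order S'" if "i \<in> P" "j \<in> P" "distinguishes G S' (\<tau> i) (\<tau> j)" for i j S'
      using Smin that unfolding D_def by blast
    \<comment> \<open>Each tangle is distinguished from another one by a separation it orients. That
      separation has at least the minimum order, so everything up to this order is oriented
      too.\<close>
    show "orients (\<tau> i) S'" if i: "i \<in> P" and S': "S' \<in> dir_separations G" "sep_order S' \<le> sep_order S"
      for i S'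
    proof -
      obtain j where j: "j \<in> P" "j \<noteq> i" using other i by blast
      then obtain S'' where S'': "distinguishes G S'' (\<tau> i) (\<tau> j)"
        using dis i j unfolding distinguishable_def by metis
      then have "sep_order S \<le> sep_order S''" using Smin i j unfolding D_def by blast
      then show ?thesis
        using tangle_orients_le[of G "\<tau> i" S'' S'] tan i distinguishes_orients[OF S''] S' by simp
    qed
  qed
  then obtain H where H: "level_separators G \<tau> P (sep_order S) H"
    using tangle_level.ex_level_separators by blast
  moreover have "H \<noteq> {}" using level_separatorsD(6)[OF H] S unfolding D_def by blast
  ultimately show thesis using that S unfolding D_def by blast
qed

text \<open>Induction on the number of tangles: both sides of a member of \<open>H\<close> are
  proper subsets of \<open>P\<close>.\<close>

lemma ex_labelled_tree:
  assumes G: "fin_digraph G" and "finite P"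
    and "\<forall>i\<in>P. tangle G (\<tau> i)"
    and "\<forall>i\<in>P. \<forall>j\<in>P. i \<noteq> j \<longrightarrow> distinguishable G (\<tau> i) (\<tau> j)"
    and "level_separators G \<tau> P k H"
  shows "\<exists>L \<gamma>. labelled_tree G \<tau> P k H L \<gamma>"
  using assms(2-)
proof (induction "card P" arbitrary: P k H rule: less_induct)
  case less
  note fin = less.prems(1) and tan = less.prems(2) and dis = less.prems(3) and level = less.prems(4)
  \<comment> \<open>Stated for arbitrary \<open>k\<close> and \<open>H\<close>, as it serves both
    the given level and, when \<open>H\<close> is empty, a higher one on the same
    \<open>P\<close>.\<close>
  have step: "\<exists>L \<gamma>. labelled_tree G \<tau> P k H L \<gamma>"
    if level: "level_separators G \<tau> P k H" and "H \<noteq> {}" for k H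
  proof -
    obtain h where h: "h \<in> H" using \<open>H \<noteq> {}\<close> by blast
    then obtain x y where "x \<in> P" "y \<in> P"
      and xy: "\<forall>S\<in>H. distinguishes G S (\<tau> x) (\<tau> y) \<longleftrightarrow> S = h"
      using level_separatorsD(7)[OF level] by meson
    note dist = level_distinguishes_iff[OF level tan h]
    have "(h \<in> \<tau> x) \<noteq> (h \<in> \<tau> y)" using xy h dist[OF \<open>x \<in> P\<close> \<open>y \<in> P\<close>] by auto
    \<comment> \<open>The private pair is renamed so that \<open>u\<close> lies on the side where
      \<open>h\<close> belongs to the tangle.\<close>
    moreover define u v where "u = (if h \<in> \<tau> x then x else y)" and "v = (if h \<in> \<tau> x then y else x)"
    ultimately have uv: "{u, v} = {x, y}" "u \<in> P" "v \<in> P" "h \<in> \<tau> u" "h \<notin> \<tau> v"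
      using \<open>x \<in> P\<close> \<open>y \<in> P\<close> by (auto split: if_splits)
    have "distinguishes G S (\<tau> u) (\<tau> v) \<longleftrightarrow> distinguishes G S (\<tau> x) (\<tau> y)" for S
      using distinguishes_commute[of G S "\<tau> x" "\<tau> y"] unfolding u_def v_def by simp
    then have uv_only: "\<forall>S\<in>H. distinguishes G S (\<tau> u) (\<tau> v) \<longleftrightarrow> S = h"
      using xy by simp
    define X where "X = {i\<in>P. h \<in> \<tau> i}"
    define Y where "Y = {i\<in>P. h \<notin> \<tau> i}"
    have XY: "X \<union> Y = P" "X \<inter> Y = {}" "u \<in> X" "v \<in> Y"
      using uv unfolding X_def Y_def by auto
    have side: "\<exists>L \<gamma>. labelled_tree G \<tau> Z k (H - {h}) L \<gamma>" if Z: "Z = X \<or> Z = Y" for Z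
    proof -
      have "Z \<subset> P" using Z XY by blast
      moreover from this have "\<And>i. i \<in> Z \<Longrightarrow> i \<in> P" by blast
      moreover have "level_separators G \<tau> Z k
          {S\<in>H - {h}. \<exists>i\<in>Z. \<exists>j\<in>Z. distinguishes G S (\<tau> i) (\<tau> j)}"
        using level_separators_side[OF level tan h] Z unfolding X_def Y_def by blast
      ultimately have "\<exists>L \<gamma>. labelled_tree G \<tau> Z k
          {S\<in>H - {h}. \<exists>i\<in>Z. \<exists>j\<in>Z. distinguishes G S (\<tau> i) (\<tau> j)} L \<gamma>"
        using fin tan dis
        by (intro less.hyps) (auto intro: psubset_card_mono finite_subset)
      then show ?thesis by (blast intro: labelled_tree_mono)
    qed
    obtain L \<gamma>L where L: "labelled_tree G \<tau> X k (H - {h}) L \<gamma>L" using side by blast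
    obtain M \<gamma>M where M: "labelled_tree G \<tau> Y k (H - {h}) M \<gamma>M" using side by blast
    have nodes: "nodes L = X" "nodes M = Y" using L M unfolding labelled_tree_def by auto
    have dt: "disjoint_trees L M u v"
      using L M XY unfolding labelled_tree_def by unfold_locales auto
    interpret disjoint_trees L M u v by (fact dt)
    \<comment> \<open>The edge \<open>{u, v}\<close> meets both sides and gets \<open>h\<close>.
      Edges of \<open>M\<close> reach the second branch only because they are nonempty.\<close>
    define \<gamma> where "\<gamma> = (\<lambda>e. if e \<subseteq> X then \<gamma>L e else if e \<subseteq> Y then \<gamma>M e else h)"
    have ne: "e \<noteq> {}" if "e \<in> edges M" for e
      using that tree_M unfolding is_tree_def simple_ugraph_def by force
    have "labelled_tree G \<tau> (nodes L) k (H - {h}) L \<gamma>"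
      using edge_sub nodes unfolding nodes
      by (intro labelled_tree_cong[OF L]) (auto simp: \<gamma>_def)
    moreover have "labelled_tree G \<tau> (nodes M) k (H - {h}) M \<gamma>"
      using edge_sub(2) ne XY(2) nodes unfolding nodes
      by (intro labelled_tree_cong[OF M]) (fastforce simp: \<gamma>_def)
    moreover have "\<gamma> {u, v} = h" using XY unfolding \<gamma>_def by auto
    moreover have "\<forall>i\<in>nodes L. \<forall>j\<in>nodes M. distinguishes G h (\<tau> i) (\<tau> j)"
      using dist unfolding nodes X_def Y_def by simp
    moreover have "nodes L \<union> nodes M = P" using nodes XY by simp
    ultimately have "labelled_tree G \<tau> P k H (join_trees L M u v) \<gamma>"
      using labelled_tree_join[OF dt _ level tan h uv_only] by blast
    then show ?thesis by blast
  qed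
  consider "card P \<le> 1" | "H \<noteq> {}" | "1 < card P" "H = {}" by linarith
  then show ?case
  proof cases
    case 1
    then show ?thesis using labelled_tree_trivial[OF fin] by blast
  next
    case 2
    then show ?thesis using step level by blast
  next
    case 3
    obtain k' H' S where k': "level_separators G \<tau> P k' H'" "H' \<noteq> {}"
      and S: "\<exists>i\<in>P. \<exists>j\<in>P. distinguishes G S (\<tau> i) (\<tau> j)" "sep_order S = k'"
      using ex_nonempty_level_separators[OF G fin 3(1) tan dis] by metis
    \<comment> \<open>An empty \<open>H\<close> means that no distinguisher in \<open>P\<close> has
      order \<open>k\<close>. So \<open>k < k'\<close>, and no label of the tree for
      \<open>k'\<close> has order \<open>k\<close>.\<close>
    have "k \<le> k'" "k' \<noteq> k"
      using level_separatorsD(1,6)[OF level, of S] S 3(2) by blast+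
    moreover obtain L \<gamma> where "labelled_tree G \<tau> P k' H' L \<gamma>" using step k' by blast
    ultimately have "labelled_tree G \<tau> P k H L \<gamma>" unfolding labelled_tree_def by fastforce
    then show ?thesis by blast
  qed
qed

end

section \<open>The labelling for the whole set of tangles\<close>

theorem theorem6p2:
  fixes G :: "('a, 'b) pre_digraph"
    and TT :: "('a, 'b) separation set set"
  assumes "fin_digraph G"
    and "\<forall>T \<in> TT. tangle G T"
    and "pairwise (distinguishable G) TT"
  shows "\<exists>(L :: nat ugraph) \<beta> \<gamma>. tree_labelling G TT L \<beta> \<gamma>"
proof -
  have "TT \<subseteq> Pow (dir_separations G)"
    using assms(2) tangle_dir_separation by blast
  then have "finite TT"
    using finite_dir_separations[OF assms(1)] by (meson finite_Pow_iff finite_subset)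
  then obtain \<beta> where \<beta>: "bij_betw \<beta> {0..<card TT} TT"
    using ex_bij_betw_nat_finite by blast
  define P where "P = {0..<card TT}"
  have P: "finite P" "bij_betw \<beta> P TT" using \<beta> unfolding P_def by auto
  have tan: "\<forall>i\<in>P. tangle G (\<beta> i)"
    using assms(2) bij_betwE[OF P(2)] by blast
  have dis: "\<forall>i\<in>P. \<forall>j\<in>P. i \<noteq> j \<longrightarrow> distinguishable G (\<beta> i) (\<beta> j)"
  proof (intro ballI impI)
    fix i j assume that: "i \<in> P" "j \<in> P" "i \<noteq> j"
    have "\<beta> i \<noteq> \<beta> j" using that P(2) unfolding bij_betw_def inj_on_def by blast
    then show "distinguishable G (\<beta> i) (\<beta> j)" using that assms(3) bij_betwE[OF P(2)] unfolding pairwise_def by blast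
  qed
  have "\<exists>k H L \<gamma>. labelled_tree G \<beta> P k H L \<gamma>"
  proof (cases "1 < card P")
    case True
    then obtain k H where "level_separators G \<beta> P k H"
      using ex_nonempty_level_separators[OF assms(1) P(1) _ tan dis] by metis
    then show ?thesis using ex_labelled_tree[OF assms(1) P(1) tan dis] by blast
  next
    \<comment> \<open>At most one tangle: no distinguisher fixes a level, and the edgeless tree
      serves, also for empty \<open>TT\<close>.\<close>
    case False
    then show ?thesis using labelled_tree_trivial[OF P(1)] by (metis linorder_not_less)
  qed
  then obtain k H L \<gamma> where lt: "labelled_tree G \<beta> P k H L \<gamma>" by blast
  then have L: "is_tree L" "nodes L = P" "min_labels G \<beta> L \<gamma>" unfolding labelled_tree_def by auto
  have cond2: "min_order_distinguisher G (\<gamma> e) (\<beta> t) (\<beta> t')"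
    if t: "t \<in> nodes L" "t' \<in> nodes L" "t \<noteq> t'" "path_between L t p t'" and e: "e \<in> path_edges p"
      and min: "sep_order (\<gamma> e) = Min ((\<lambda>e'. sep_order (\<gamma> e')) ` path_edges p)" for t t' p e
  proof -
    have "\<forall>e'\<in>path_edges p. sep_order (\<gamma> e) \<le> sep_order (\<gamma> e')"
      unfolding min by (intro ballI Min_le) (auto simp: finite_path_edges)
    then show ?thesis using min_labelsD[OF L(3) t(4,3,1,2) e] by blast
  qed
  have cond3: "\<exists>t \<in> component_of (delete_edge L {s, s'}) s.
      \<exists>t' \<in> component_of (delete_edge L {s, s'}) s'.
        min_order_distinguisher G (\<gamma> {s, s'}) (\<beta> t) (\<beta> t')" if e: "{s, s'} \<in> edges L" for s s'
  proof (intro bexI)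
    have s: "s \<in> nodes L" "s' \<in> nodes L" "s \<noteq> s'"
      using e L(1) unfolding is_tree_def simple_ugraph_def by force+
    have pe: "path_edges [s, s'] = {{s, s'}}"
      using path_edges_append[of "[s]" "[s']"] by simp
    \<comment> \<open>The ends of the edge are the witnesses: each lies in its own component, and
      the path between them has only this edge, which is therefore minimal.\<close>
    have "path_between L s [s, s'] s'"
      using s e unfolding path_between_def adjacent_def by simp
    then show "min_order_distinguisher G (\<gamma> {s, s'}) (\<beta> s) (\<beta> s')"
      using cond2[OF s, of "[s, s']"] pe by simp
    show "s \<in> component_of (delete_edge L {s, s'}) s"
      "s' \<in> component_of (delete_edge L {s, s'}) s'"
      using s path_between_refl_iff[of "delete_edge L {s, s'}"]
      unfolding component_of_def delete_edge_def by auto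
  qed
  have "tree_labelling G TT L \<beta> \<gamma>"
    unfolding tree_labelling_def
  proof (intro conjI ballI allI impI)
    show "is_tree L" by (fact L(1))
    show "bij_betw \<beta> (nodes L) TT" using P(2) L(2) by simp
    show "\<gamma> e \<in> dir_separations G" if "e \<in> edges L" for e
      using labelled_treeD(4)[OF lt that] .
  qed (use cond2 cond3 in blast)+
  then show ?thesis by blast
qed

end
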